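(* Let $X$ be a real Lévy process with Lévy measure $\pi$, and let $\zeta$ be the absorption time at $0$ of the Lévy process $X$ resurrected in the positive half-line. Then $P_x(\zeta=\infty)=1$ for all $x>0$ in either of the following cases: (a) $X$ does not creep downward and $0<\pi((-\infty,0))<\infty$; (b) $0$ is not regular for $(-\infty,0)$.
   Context: Let $X=(X_t)_{t\ge0}$ be a real-valued Lévy process (with infinite lifetime). $\mathbb{P}_x$ denotes the law under which $X$ is this Lévy process started from $X_0=x$, and $\tau=\inf\{t\ge0:X_t\le0\}$ (with $\inf\emptyset=\infty$). $X$ creeps downward if for all $x>0$, $\mathbb{P}_x(X_{\tau-}=0,\ \tau<\infty)>0$. The point $0$ is regular for $(-\infty,0)$ if $\inf\{t>0:X_t<0\}=0$ almost surely under $\mathbb{P}_0$. Resurrected process. Fix $x\ge0$ and let $X^{(1)}$ be the Lévy process started from $x$. For $n\ge1$ let $\tau_n=\inf\{t\ge0:X^{(n)}_t\le0\}$. If $\tau_n=\infty$ set $X^{(n+1)}=X^{(n)}$. If $\tau_n<\infty$ set $X^{(n+1)}_t=X^{(n)}_t$ for $t<\tau_n$ and $X^{(n+1)}_t=X^{(n)}_t-(X^{(n)}_{\tau_n}-X^{(n)}_{\tau_n-})$ for $t\ge\tau_n$ (the jump at $\tau_n$ is removed; there is no jump at time $0$). The sequence $(\tau_n)$ is nondecreasing. The resurrected process is $Z_t=\lim_{n\to\infty}X^{(n)}_t\mathbf 1_{\{t<\tau_n\}}$, $t\ge0$; it is a nonnegative process started from $x$ and absorbed at $0$. Its absorption time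 is $\zeta=\inf\{t:Z_t=0\}=\lim_{n\to\infty}\tau_n\in[0,\infty]$. $P_x$ denotes the law of $Z$ started from $x$. *)

theory Defs
  imports "HOL-Probability.Probability"
begin

(* Paths are functions on the real line of which only the values at times t >= 0 matter. *)

definition cadlag :: "(real \<Rightarrow> real) \<Rightarrow> bool" where
  "cadlag f \<longleftrightarrow>
     (\<forall>t\<ge>0. (f \<longlongrightarrow> f t) (at_right t)) \<and>
     (\<forall>t>0. \<exists>l. (f \<longlongrightarrow> l) (at_left t))"

(* A Levy process with X_0 = 0; started from x it is the process x + X. *)
locale levy_process = prob_space M for M :: "'a measure" +
  fixes X :: "real \<Rightarrow> 'a \<Rightarrow> real"
  assumes measurable_X: "\<And>t. 0 \<le> t \<Longrightarrow> X t \<in> borel_measurable M"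
    and start_zero: "AE \<omega> in M. X 0 \<omega> = 0"
    and indep_increments:
      "\<And>(n::nat) (t::nat \<Rightarrow> real). 0 \<le> t 0 \<Longrightarrow> (\<And>i. i < n \<Longrightarrow> t i \<le> t (Suc i)) \<Longrightarrow>
         indep_vars (\<lambda>_. borel) (\<lambda>i \<omega>. X (t (Suc i)) \<omega> - X (t i) \<omega>) {..<n}"
    and stationary_increments:
      "\<And>s h. 0 \<le> s \<Longrightarrow> 0 \<le> h \<Longrightarrow>
         distr M borel (\<lambda>\<omega>. X (s + h) \<omega> - X s \<omega>) = distr M borel (X h)"
    and cadlag_paths: "AE \<omega> in M. cadlag (\<lambda>t. X t \<omega>)"

definition left_limit :: "(real \<Rightarrow> real) \<Rightarrow> real \<Rightarrow> real" where
  "left_limit f t = Lim (at_left t) f"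

definition jump_at :: "(real \<Rightarrow> real) \<Rightarrow> real \<Rightarrow> real" where
  "jump_at f t = (if 0 < t then f t - left_limit f t else 0)"

(* \<pi>(A) is the expected number of nonzero jumps of X in the time interval (0,1]
   whose size lies in A. *)
definition has_levy_measure ::
  "'a measure \<Rightarrow> (real \<Rightarrow> 'a \<Rightarrow> real) \<Rightarrow> real measure \<Rightarrow> bool" where
  "has_levy_measure M X \<pi> \<longleftrightarrow>
     sets \<pi> = sets borel \<and>
     (\<forall>A\<in>sets borel. emeasure \<pi> A =
        (\<integral>\<^sup>+\<omega>. emeasure (count_space UNIV)
             {t\<in>{0<..1}. jump_at (\<lambda>s. X s \<omega>) t \<noteq> 0 \<and> jump_at (\<lambda>s. X s \<omega>) t \<in> A} \<partial>M))"

definition passage_time :: "(real \<Rightarrow> real) \<Rightarrow> ereal" where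
  "passage_time f = (INF t\<in>{t. 0 \<le> t \<and> f t \<le> 0}. ereal t)"

(* "Has positive probability" is expressed as "is not almost surely false", so that
   no measurability of the event with respect to the uncompleted M is needed. *)
definition creeps_downward :: "'a measure \<Rightarrow> (real \<Rightarrow> 'a \<Rightarrow> real) \<Rightarrow> bool" where
  "creeps_downward M X \<longleftrightarrow>
     (\<forall>x>0. \<not> (AE \<omega> in M.
        \<not> (passage_time (\<lambda>t. x + X t \<omega>) < \<infinity> \<and>
           left_limit (\<lambda>t. x + X t \<omega>)
             (real_of_ereal (passage_time (\<lambda>t. x + X t \<omega>))) = 0)))"

definition zero_regular_for_negative :: "'a measure \<Rightarrow> (real \<Rightarrow> 'a \<Rightarrow> real) \<Rightarrow> bool" where
  "zero_regular_for_negative M X \<longleftrightarrow>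
     (AE \<omega> in M. (INF t\<in>{t. 0 < t \<and> X t \<omega> < 0}. ereal t) = 0)"

definition remove_passage_jump :: "(real \<Rightarrow> real) \<Rightarrow> real \<Rightarrow> real" where
  "remove_passage_jump f =
     (if passage_time f = \<infinity> then f
      else (\<lambda>t. if ereal t < passage_time f then f t
                else f t - jump_at f (real_of_ereal (passage_time f))))"

(* The sequence is indexed from 0 here: resurrection_step f 0 is the original path f. *)
primrec resurrection_step :: "(real \<Rightarrow> real) \<Rightarrow> nat \<Rightarrow> real \<Rightarrow> real" where
  "resurrection_step f 0 = f"
| "resurrection_step f (Suc n) = remove_passage_jump (resurrection_step f n)"

definition resurrected :: "(real \<Rightarrow> real) \<Rightarrow> real \<Rightarrow> real" where
  "resurrected f t =
     lim (\<lambda>n. if ereal t < passage_time (resurrection_step f n)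
              then resurrection_step f n t else 0)"

definition absorption_time :: "(real \<Rightarrow> real) \<Rightarrow> ereal" where
  "absorption_time f = (INF t\<in>{t. 0 \<le> t \<and> resurrected f t = 0}. ereal t)"

end

theory Submission
  imports Defs
begin

text \<open>
  Condition (a) implies (b). If \<open>X\<close> had with positive probability a descent by \<open>\<epsilon>\<close> without negative
  jumps, then independent copies of it would lead without negative jumps below any level, and thus
  \<open>X\<close> would creep; hence \<open>X\<close> stays nonnegative until its first negative jump. If \<open>0\<close> were regular,
  negative jumps would then accumulate at time \<open>0\<close>, which contradicts the finiteness of
  \<open>\<pi>((-\<infinity>, 0))\<close>.

  Under (b), the paths of \<open>X\<close> attain their minimum over every interval \<open>[0, s)\<close>. Otherwise strict
  records would accumulate, and for every \<open>m\<close> the random walk of \<open>X\<close> on each sufficiently fine time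
  grid would have at least \<open>m\<close> strict descents in a fixed time interval. Since \<open>0\<close> is not regular, each
  waiting time for a descent exceeds a fixed \<open>\<delta>\<close> with probability at least \<open>p > 0\<close> on every fine grid,
  so the probability of \<open>m\<close> descents tends to \<open>0\<close> as \<open>m\<close> grows, uniformly in the grid.

  If the minimum over every \<open>[0, s)\<close> is attained, then the left limit at each passage time is
  positive, the resurrected path inherits the property, and the passage times, being strict record
  times of the original path, cannot accumulate.
\<close>

section \<open>Paths whose past minima are attained\<close>

lemma cadlag_tendsto_right: "cadlag f \<Longrightarrow> 0 \<le> t \<Longrightarrow> (f \<longlongrightarrow> f t) (at_right t)"
  by (simp add: cadlag_def)

lemma cadlag_tendsto_left: "cadlag f \<Longrightarrow> 0 < t \<Longrightarrow> (f \<longlongrightarrow> left_limit f t) (at_left t)"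
  unfolding cadlag_def left_limit_def
  by (metis tendsto_Lim trivial_limit_at_left_real)

lemma cadlag_shift:
  assumes "cadlag f"
  shows "cadlag (\<lambda>t. x + f t)"
  unfolding cadlag_def
proof (intro conjI allI impI)
  fix t :: real
  show "((\<lambda>t. x + f t) \<longlongrightarrow> x + f t) (at_right t)" if "0 \<le> t"
    by (intro tendsto_intros cadlag_tendsto_right[OF assms that])
  show "\<exists>l. ((\<lambda>t. x + f t) \<longlongrightarrow> l) (at_left t)" if "0 < t"
    using tendsto_add[OF tendsto_const cadlag_tendsto_left[OF assms that]] by blast
qed

text \<open>By right continuity the set of times with value at most 0 contains its infimum, so the
  path is already nonpositive at the passage time.\<close>

lemma passage_time_cases:
  assumes "cadlag f"
  obtains (never) "passage_time f = \<infinity>" "\<And>t. 0 \<le> t \<Longrightarrow> 0 < f t"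
  | (passes) \<tau> where "0 \<le> \<tau>" "passage_time f = ereal \<tau>" "f \<tau> \<le> 0"
      "\<And>t. 0 \<le> t \<Longrightarrow> t < \<tau> \<Longrightarrow> 0 < f t"
proof (cases "{t. 0 \<le> t \<and> f t \<le> 0} = {}")
  case True
  then have "passage_time f = \<infinity>"
    unfolding passage_time_def by (metis INF_empty top_ereal_def)
  then show thesis using True by (intro never) force+
next
  case False
  let ?T = "{t. 0 \<le> t \<and> f t \<le> 0}"
  define \<tau> where "\<tau> = Inf ?T"
  have bdd: "bdd_below ?T" by (auto intro: bdd_belowI[of _ 0])
  have "0 \<le> \<tau>" unfolding \<tau>_def using False by (intro cInf_greatest) auto
  moreover have "passage_time f = ereal \<tau>"
    unfolding passage_time_def \<tau>_def using ereal_Inf'[OF bdd False] by simp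
  moreover have "f \<tau> \<le> 0"
  proof (rule ccontr)
    assume "\<not> f \<tau> \<le> 0"
    then have "eventually (\<lambda>t. 0 < f t) (at_right \<tau>)"
      using cadlag_tendsto_right[OF assms \<open>0 \<le> \<tau>\<close>] by (auto intro: order_tendstoD)
    then obtain b where b: "b > \<tau>" "\<And>t. \<tau> < t \<Longrightarrow> t < b \<Longrightarrow> 0 < f t"
      by (auto simp: eventually_at_right_field)
    from cInf_lessD[OF False] b(1) obtain t where "t \<in> ?T" "t < b" unfolding \<tau>_def by blast
    moreover have "\<tau> \<le> t" unfolding \<tau>_def using \<open>t \<in> ?T\<close> bdd by (rule cInf_lower)
    ultimately show False using b(2)[of t] \<open>\<not> f \<tau> \<le> 0\<close> by (cases "t = \<tau>") auto
  qed
  moreover have "0 < f t" if "0 \<le> t" "t < \<tau>" for t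
    using that cInf_lower[OF _ bdd, of t] unfolding \<tau>_def by force
  ultimately show thesis by (rule passes)
qed

text \<open>For a cadlag path this fails exactly when on some [0, s) the infimum is only approached,
  through a left limit. The interval is open at \<open>s\<close> because a downward jump at
  \<open>s\<close> itself is harmless.\<close>

definition past_min_attained :: "(real \<Rightarrow> real) \<Rightarrow> bool" where
  "past_min_attained f \<longleftrightarrow> (\<forall>s>0. \<exists>u. 0 \<le> u \<and> u < s \<and> (\<forall>t. 0 \<le> t \<longrightarrow> t < s \<longrightarrow> f u \<le> f t))"

lemma past_min_attained_shift: "past_min_attained (\<lambda>t. x + f t) \<longleftrightarrow> past_min_attained f"
  by (simp add: past_min_attained_def)

text \<open>The minimum over [0, \<tau>) is attained, hence positive, so the left limit at \<tau>,
  which is the new value at \<tau>, is positive as well. The new path is \<open>g\<close> before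
  \<tau> and a translate of \<open>g\<close> from \<tau> on; the last two conclusions record this
  for comparing later steps with the original path.\<close>

lemma remove_passage_jump_props:
  assumes g: "cadlag g" "past_min_attained g" "0 < g 0"
    and \<tau>: "passage_time g = ereal \<tau>"
  shows "cadlag (remove_passage_jump g)"
    and "past_min_attained (remove_passage_jump g)"
    and "\<And>t. 0 \<le> t \<Longrightarrow> t \<le> \<tau> \<Longrightarrow> 0 < remove_passage_jump g t"
    and "0 < \<tau>"
    and "\<And>t. t < \<tau> \<Longrightarrow> remove_passage_jump g t = g t"
    and "\<exists>c. \<forall>t\<ge>\<tau>. remove_passage_jump g t = g t + c"
proof -
  have gt: "g \<tau> \<le> 0" "\<And>t. 0 \<le> t \<Longrightarrow> t < \<tau> \<Longrightarrow> 0 < g t" and "0 \<le> \<tau>"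
    using passage_time_cases[OF g(1)] \<tau> by auto
  show "0 < \<tau>" using \<open>0 \<le> \<tau>\<close> gt(1) g(3) by (cases "\<tau> = 0") auto
  define c where "c = - jump_at g \<tau>"
  define g' where "g' = remove_passage_jump g"
  have g': "g' t = (if t < \<tau> then g t else g t + c)" for t
    by (simp add: g'_def c_def remove_passage_jump_def \<tau>)
  then show "\<And>t. t < \<tau> \<Longrightarrow> remove_passage_jump g t = g t"
    and "\<exists>c. \<forall>t\<ge>\<tau>. remove_passage_jump g t = g t + c"
    by (auto simp: g'_def[symmetric])
  have g'\<tau>: "g' \<tau> = left_limit g \<tau>"
    using g'[of \<tau>] \<open>0 < \<tau>\<close> by (simp add: c_def jump_at_def)
  obtain u where u: "0 \<le> u" "u < \<tau>" "\<And>t. 0 \<le> t \<Longrightarrow> t < \<tau> \<Longrightarrow> g u \<le> g t"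
    using g(2) \<open>0 < \<tau>\<close> unfolding past_min_attained_def by blast
  have "eventually (\<lambda>t. g u \<le> g t) (at_left \<tau>)"
    using eventually_at_left_real[OF \<open>0 < \<tau>\<close>] by eventually_elim (use u(3) in auto)
  then have "g u \<le> left_limit g \<tau>"
    by (intro tendsto_lowerbound[OF cadlag_tendsto_left[OF g(1) \<open>0 < \<tau>\<close>]]) auto
  then have "0 < g' \<tau>" using gt(2)[OF u(1,2)] g'\<tau> by simp
  then show pos: "\<And>t. 0 \<le> t \<Longrightarrow> t \<le> \<tau> \<Longrightarrow> 0 < remove_passage_jump g t"
    unfolding g'_def[symmetric] using gt(2) g' by (metis order_le_less)
  show "cadlag (remove_passage_jump g)"
    unfolding g'_def[symmetric] cadlag_def
  proof (intro conjI allI impI)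
    fix t :: real assume "0 \<le> t"
    note r = cadlag_tendsto_right[OF g(1) this]
    show "(g' \<longlongrightarrow> g' t) (at_right t)"
    proof (cases "t < \<tau>")
      case True
      have "eventually (\<lambda>s. g s = g' s) (at_right t)"
        using eventually_at_right_real[OF True] by eventually_elim (simp add: g')
      from Lim_transform_eventually[OF r this] show ?thesis using True by (subst g') simp
    next
      case False
      have "eventually (\<lambda>s. g s + c = g' s) (at_right t)"
        using eventually_at_right_less[of t] by eventually_elim (use False in \<open>simp add: g'\<close>)
      from Lim_transform_eventually[OF tendsto_add[OF r tendsto_const] this]
      show ?thesis using False by (subst g') simp
    qed
  next
    fix t :: real assume "0 < t"
    note l = cadlag_tendsto_left[OF g(1) this]
    show "\<exists>l. (g' \<longlongrightarrow> l) (at_left t)"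
    proof (cases "t \<le> \<tau>")
      case True
      have "eventually (\<lambda>s. g s = g' s) (at_left t)"
        using eventually_at_left_real[OF \<open>0 < t\<close>] by eventually_elim (use True in \<open>simp add: g'\<close>)
      from Lim_transform_eventually[OF l this] show ?thesis by blast
    next
      case False
      then have "\<tau> < t" by simp
      have "eventually (\<lambda>s. g s + c = g' s) (at_left t)"
        using eventually_at_left_real[OF \<open>\<tau> < t\<close>] by eventually_elim (simp add: g')
      from Lim_transform_eventually[OF tendsto_add[OF l tendsto_const] this]
      show ?thesis by blast
    qed
  qed
  show "past_min_attained (remove_passage_jump g)"
    unfolding g'_def[symmetric] past_min_attained_def
  proof (intro allI impI)
    fix s :: real assume "0 < s"
    then obtain w where w: "0 \<le> w" "w < s" "\<And>t. 0 \<le> t \<Longrightarrow> t < s \<Longrightarrow> g w \<le> g t"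
      using g(2) unfolding past_min_attained_def by blast
    show "\<exists>u. 0 \<le> u \<and> u < s \<and> (\<forall>t. 0 \<le> t \<longrightarrow> t < s \<longrightarrow> g' u \<le> g' t)"
    proof (cases "s \<le> \<tau>")
      case True
      then show ?thesis using w g' by (intro exI[of _ w]) auto
    next
      case False
      then have "g w \<le> g \<tau>" using \<open>0 < \<tau>\<close> by (intro w) auto
      \<comment> \<open>\<open>g\<close> is positive before \<tau> and at most 0 at \<tau>, so its
        minimiser over [0, s) lies in [\<tau>, s) and also minimises the translate there. The
        smaller of the values of \<open>g'\<close> at \<open>u\<close> and \<open>w\<close> is then
        the minimum of \<open>g'\<close>.\<close>
      then have "\<tau> \<le> w" using gt w(1) by (meson leD le_less_trans leI order_trans)
      define v where "v = (if g' u \<le> g' w then u else w)"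
      have "g' u \<le> g' t" if "0 \<le> t" "t < \<tau>" for t using that u by (simp add: g')
      moreover have "g' w \<le> g' t" if "\<tau> \<le> t" "t < s" for t
        using that w \<open>0 < \<tau>\<close> \<open>\<tau> \<le> w\<close> by (simp add: g')
      ultimately have "g' v \<le> g' t" if "0 \<le> t" "t < s" for t
        using that unfolding v_def by (smt (verit))
      moreover have "0 \<le> v" "v < s" using u w False by (auto simp: v_def)
      ultimately show ?thesis by blast
    qed
  qed
qed

section \<open>The resurrection sequence and its limit\<close>

lemma resurrection_step_props:
  assumes "cadlag f" "past_min_attained f" "0 < f 0"
  shows "cadlag (resurrection_step f n) \<and> past_min_attained (resurrection_step f n)
    \<and> 0 < resurrection_step f n 0"
proof (induction n)
  case 0
  then show ?case using assms by simp
next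
  case (Suc n)
  let ?g = "resurrection_step f n"
  from Suc have "cadlag ?g" by simp
  then show ?case
  proof (cases rule: passage_time_cases)
    case never
    then show ?thesis using Suc by (simp add: remove_passage_jump_def)
  next
    case (passes \<tau>)
    then show ?thesis
      using remove_passage_jump_props(1,2,3)[of ?g \<tau>] Suc by auto
  qed
qed

text \<open>If every passage time were at most \<open>t\<close>, they would increase strictly to
  some \<open>s\<close>, and each would be a strict record time of \<open>f\<close>. A minimiser
  \<open>u\<close> over [0, s) would lie before some \<open>\<tau> n\<close>, where \<open>f\<close>
  is smaller still. Hence some passage time exceeds \<open>t\<close>, and from then on the steps
  leave the value at \<open>t\<close> unchanged.\<close>

lemma resurrected_pos:
  assumes f: "cadlag f" "past_min_attained f" "0 < f 0" and t: "0 \<le> t"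
  shows "0 < resurrected f t"
proof -
  define g where "g = resurrection_step f"
  have props: "cadlag (g n)" "past_min_attained (g n)" "0 < g n 0" for n
    using resurrection_step_props[OF f] by (auto simp: g_def)
  have g_Suc: "g (Suc n) = remove_passage_jump (g n)" and g_0: "g 0 = f" for n
    by (simp_all add: g_def)
  define y where "y n = (if ereal t < passage_time (g n) then g n t else 0)" for n
  have y_pos: "0 < y n" if "ereal t < passage_time (g n)" for n
    using props(1)[of n]
  proof (cases rule: passage_time_cases)
    case never
    then show ?thesis using t by (simp add: y_def)
  next
    case (passes \<tau>)
    then show ?thesis using t that by (simp add: y_def)
  qed
  have "\<exists>n. ereal t < passage_time (g n)"
  proof (rule ccontr)
    assume "\<not> ?thesis"
    then have le: "passage_time (g n) \<le> ereal t" for n by (simp add: not_less)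
    define \<tau> where "\<tau> n = real_of_ereal (passage_time (g n))" for n
    have \<tau>: "passage_time (g n) = ereal (\<tau> n)" "g n (\<tau> n) \<le> 0"
      "\<And>s. 0 \<le> s \<Longrightarrow> s < \<tau> n \<Longrightarrow> 0 < g n s" for n
    proof -
      obtain \<sigma> where "passage_time (g n) = ereal \<sigma>" "g n \<sigma> \<le> 0"
        "\<And>s. 0 \<le> s \<Longrightarrow> s < \<sigma> \<Longrightarrow> 0 < g n s"
        using props(1)[of n] by (cases rule: passage_time_cases) (use le[of n] in auto)
      then show "passage_time (g n) = ereal (\<tau> n)" "g n (\<tau> n) \<le> 0"
        "\<And>s. 0 \<le> s \<Longrightarrow> s < \<tau> n \<Longrightarrow> 0 < g n s"
        by (simp_all add: \<tau>_def)
    qed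
    note step = remove_passage_jump_props[OF props \<tau>(1), folded g_Suc]
    have mono: "\<tau> n < \<tau> (Suc n)" for n
      using step(3)[of "\<tau> (Suc n)" n] \<tau>(2)[of "Suc n"] step(4)[of "Suc n"] by fastforce
    have "\<tau> n \<le> t" for n using le[of n] \<tau>(1)[of n] by simp
    then have bdd: "bdd_above (range \<tau>)" by (auto intro: bdd_aboveI[of _ t])
    define s where "s = (SUP n. \<tau> n)"
    have \<tau>s: "\<tau> n < s" for n
      using mono[of n] cSUP_upper[OF _ bdd, of "Suc n"] unfolding s_def by simp
    \<comment> \<open>For \<open>n = 0\<close> the path is \<open>f\<close> at all times; for
      \<open>n = Suc m\<close> it is known to be a translate of \<open>f\<close> only from the last
      repaired time \<open>\<tau> m\<close> on. The premise on \<open>m\<close> covers both cases in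
      one induction.\<close>
    have "(\<exists>c. \<forall>r. 0 \<le> r \<and> (\<forall>m. n = Suc m \<longrightarrow> \<tau> m \<le> r) \<longrightarrow> g n r = f r + c)
        \<and> (\<forall>r. 0 \<le> r \<and> r < \<tau> n \<longrightarrow> f (\<tau> n) < f r)" for n
    proof (induction n)
      case 0
      have "f (\<tau> 0) < f r" if "0 \<le> r" "r < \<tau> 0" for r
        using \<tau>(2)[of 0] \<tau>(3)[of r 0] that by (simp add: g_0)
      moreover have "\<forall>r. g 0 r = f r + 0" by (simp add: g_0)
      ultimately show ?case by blast
    next
      case (Suc n)
      then obtain c where c: "\<And>r. 0 \<le> r \<Longrightarrow> (\<And>m. n = Suc m \<Longrightarrow> \<tau> m \<le> r) \<Longrightarrow> g n r = f r + c"
        and rec: "\<And>r. 0 \<le> r \<Longrightarrow> r < \<tau> n \<Longrightarrow> f (\<tau> n) < f r" by blast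
      obtain c' where c': "\<And>r. \<tau> n \<le> r \<Longrightarrow> g (Suc n) r = g n r + c'"
        using step(6)[of n] by blast
      have eq: "g (Suc n) r = f r + (c + c')" if "\<tau> n \<le> r" for r
      proof -
        have "g n r = f r + c"
        proof (rule c)
          show "0 \<le> r" using that step(4)[of n] by simp
          show "\<tau> m \<le> r" if "n = Suc m" for m
            using mono[of m] \<open>\<tau> n \<le> r\<close> that by simp
        qed
        then show ?thesis using c'[OF that] by simp
      qed
      \<comment> \<open>From \<open>\<tau> n\<close> on the new path differs from \<open>f\<close>
        by one constant, is positive until its passage and nonpositive there. Times before
        \<open>\<tau> n\<close> are covered by the record at \<open>\<tau> n\<close>.\<close>
      have "f (\<tau> (Suc n)) < f r" if "\<tau> n \<le> r" "r < \<tau> (Suc n)" for r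
        using eq[OF that(1)] eq[of "\<tau> (Suc n)"] mono[of n] \<tau>(2)[of "Suc n"] \<tau>(3)[of r "Suc n"]
          that step(4)[of n] by simp
      then have "f (\<tau> (Suc n)) < f r" if "0 \<le> r" "r < \<tau> (Suc n)" for r
        using that rec[of r] mono[of n] by (meson less_le_trans linorder_not_le order_refl order.strict_trans)
      then show ?case using eq by (metis (no_types, lifting))
    qed
    then have rec: "f (\<tau> n) < f r" if "0 \<le> r" "r < \<tau> n" for n r using that by blast
    have "0 < s" using \<tau>s[of 0] step(4)[of 0] by simp
    then obtain u where u: "0 \<le> u" "u < s" "\<And>r. 0 \<le> r \<Longrightarrow> r < s \<Longrightarrow> f u \<le> f r"
      using f(2) unfolding past_min_attained_def by blast
    from u(2) obtain n where "u < \<tau> n" unfolding s_def using less_cSUP_iff[OF _ bdd] by auto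
    then show False using rec[OF u(1)] u(3)[of "\<tau> n"] \<tau>s step(4)[of n] by fastforce
  qed
  then obtain n where n: "ereal t < passage_time (g n)" by blast
  have "ereal t < passage_time (g m) \<and> g m t = g n t" if "n \<le> m" for m
    using that
  proof (induction m rule: dec_induct)
    case base
    then show ?case using n by simp
  next
    case (step m)
    show ?case
      using props(1)[of m]
    proof (cases rule: passage_time_cases)
      case never
      then show ?thesis using step by (simp add: g_Suc remove_passage_jump_def)
    next
      case (passes \<tau>)
      note st = remove_passage_jump_props[OF props passes(2), folded g_Suc]
      have "t < \<tau>" using step passes by simp
      then have "g (Suc m) t = g n t" using st(5) step by simp
      moreover have "ereal t < passage_time (g (Suc m))"
        using props(1)[of "Suc m"]
      proof (cases rule: passage_time_cases)
        case p2: (passes \<sigma>)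
        then have "\<tau> < \<sigma>" using st(3)[of \<sigma>] by force
        then show ?thesis using p2 \<open>t < \<tau>\<close> by simp
      qed simp
      ultimately show ?thesis by simp
    qed
  qed
  then have "y m = y n" if "n \<le> m" for m
    unfolding y_def using that n by presburger
  then have "eventually (\<lambda>m. y m = y n) sequentially"
    by (intro eventually_sequentiallyI)
  then have "lim y = y n" by (intro limI tendsto_eventually)
  then have "resurrected f t = y n"
    unfolding resurrected_def y_def g_def .
  then show ?thesis using y_pos[OF n] by simp
qed

lemma absorption_time_eq_infinity:
  assumes "cadlag f" "past_min_attained f" "0 < f 0"
  shows "absorption_time f = \<infinity>"
proof -
  have "{t. 0 \<le> t \<and> resurrected f t = 0} = {}"
    using resurrected_pos[OF assms] by fastforce
  then show ?thesis unfolding absorption_time_def by (metis INF_empty top_ereal_def)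
qed

section \<open>Descents of random walks\<close>

definition iid :: "real measure \<Rightarrow> (nat \<Rightarrow> real) measure" where
  "iid \<mu> = PiM UNIV (\<lambda>_. \<mu>)"

definition walk :: "(nat \<Rightarrow> real) \<Rightarrow> nat \<Rightarrow> real" where
  "walk v n = (\<Sum>i<n. v i)"

lemma sets_iid: "sets \<mu> = sets borel \<Longrightarrow> sets (iid \<mu>) = sets (PiM UNIV (\<lambda>_. borel))"
  unfolding iid_def by (intro sets_PiM_cong) auto

lemma space_iid: "sets \<mu> = sets borel \<Longrightarrow> space (iid \<mu>) = UNIV"
  using sets_eq_imp_space_eq[OF sets_iid, of \<mu>] by (simp add: space_PiM)

lemma prob_space_iid: "prob_space \<mu> \<Longrightarrow> prob_space (iid \<mu>)"
  unfolding iid_def by (intro prob_space_PiM)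

lemma measurable_shift:
  "(\<lambda>v i. v (j + i)) \<in> PiM UNIV (\<lambda>_. borel) \<rightarrow>\<^sub>M PiM UNIV (\<lambda>_::nat. borel :: real measure)"
  by (rule measurable_PiM_single') (auto simp: space_PiM)

lemma pred_shift:
  assumes "Measurable.pred (PiM UNIV (\<lambda>_::nat. borel :: real measure)) Q"
  shows "Measurable.pred (PiM UNIV (\<lambda>_. borel)) (\<lambda>v. Q (\<lambda>i. v (j + i)))"
  by (rule measurable_compose[OF measurable_shift assms])

lemma measurable_walk [measurable]:
  "(\<lambda>v. walk v n) \<in> PiM UNIV (\<lambda>_. borel) \<rightarrow>\<^sub>M borel"
  unfolding walk_def by measurable

text \<open>\<open>comb_seq\<close> glues the first \<open>j\<close> entries of one sequence to an
  independent second sequence and preserves the product law. Since \<open>P\<close> sees only the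
  first sequence and \<open>Q\<close> only the second, the preimage of the event is a
  rectangle.\<close>

lemma iid_split:
  assumes \<mu>: "prob_space \<mu>" "sets \<mu> = sets borel"
    and P [measurable]: "Measurable.pred (PiM UNIV (\<lambda>_. borel)) P"
    and Q [measurable]: "Measurable.pred (PiM UNIV (\<lambda>_. borel)) Q"
    and dep: "\<And>v w. (\<And>i. i < j \<Longrightarrow> v i = w i) \<Longrightarrow> P v = P w"
  shows "measure (iid \<mu>) {v. P v \<and> Q (\<lambda>i. v (j + i))}
    = measure (iid \<mu>) {v. P v} * measure (iid \<mu>) {v. Q v}"
proof -
  interpret prob_space \<mu> by fact
  interpret sequence_space \<mu> by unfold_locales
  have S: "sets S = sets (PiM UNIV (\<lambda>_. borel))" "space S = UNIV"
    using sets_iid[OF \<mu>(2)] space_iid[OF \<mu>(2)] by (simp_all add: iid_def)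
  have [measurable]: "Measurable.pred S P" "Measurable.pred S Q"
    using P Q by (simp_all add: measurable_cong_sets[OF S(1) refl])
  note pred_shift[OF Q, measurable]
  have mb: "{v. P v \<and> Q (\<lambda>i. v (j + i))} \<in> sets S"
  proof -
    have "{v \<in> space (PiM UNIV (\<lambda>_. borel)). P v \<and> Q (\<lambda>i. v (j + i))}
        \<in> sets (PiM UNIV (\<lambda>_. borel :: real measure))" by measurable
    then show ?thesis unfolding S(1) by (simp add: space_PiM)
  qed
  have PQ: "{v. P v} \<in> sets S" "{v. Q v} \<in> sets S"
    using \<open>Measurable.pred S P\<close> \<open>Measurable.pred S Q\<close> by (simp_all add: pred_def S(2))
  have "P (comb_seq j v w) = P v" "(\<lambda>i. comb_seq j v w (j + i)) = w" for v w
    by (rule dep) (auto simp: comb_seq_def)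
  then have vimage: "(\<lambda>(v, w). comb_seq j v w) -` {v. P v \<and> Q (\<lambda>i. v (j + i))} \<inter> space (S \<Otimes>\<^sub>M S)
      = {v. P v} \<times> {w. Q w}"
    by (auto simp: space_pair_measure S(2))
  have "emeasure S {v. P v \<and> Q (\<lambda>i. v (j + i))}
      = emeasure (distr (S \<Otimes>\<^sub>M S) S (\<lambda>(v, w). comb_seq j v w)) {v. P v \<and> Q (\<lambda>i. v (j + i))}"
    by (simp only: PiM_comb_seq)
  also have "\<dots> = emeasure (S \<Otimes>\<^sub>M S) ({v. P v} \<times> {w. Q w})"
    by (simp only: emeasure_distr[OF measurable_comb_seq mb] vimage)
  also have "\<dots> = emeasure S {v. P v} * emeasure S {v. Q v}"
    using PQ by (rule P.emeasure_pair_measure_Times)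
  finally show ?thesis
    by (simp add: iid_def measure_def enn2real_mult)
qed

section \<open>Strict descending ladder epochs of a random walk\<close>

definition first_descent :: "nat \<Rightarrow> (nat \<Rightarrow> real) \<Rightarrow> bool" where
  "first_descent j v \<longleftrightarrow> (\<forall>i<j. 0 \<le> walk v i) \<and> walk v j < 0"

text \<open>This says that at least \<open>m\<close> strict descending ladder epochs occur up to
  time \<open>J\<close>. Restarting the walk at its first descent gives the form to which
  \<open>iid_split\<close> applies.\<close>

primrec descents :: "nat \<Rightarrow> nat \<Rightarrow> (nat \<Rightarrow> real) \<Rightarrow> bool" where
  "descents 0 J v = True"
| "descents (Suc m) J v = (\<exists>j\<le>J. first_descent j v \<and> descents m (J - j) (\<lambda>i. v (j + i)))"

lemma measurable_first_descent [measurable]: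
  "Measurable.pred (PiM UNIV (\<lambda>_. borel)) (first_descent j)"
  unfolding first_descent_def[abs_def] by measurable

lemma measurable_descents [measurable]:
  "Measurable.pred (PiM UNIV (\<lambda>_. borel)) (descents m J)"
proof (induction m arbitrary: J)
  case 0
  have "descents 0 J = (\<lambda>v. True)" by auto
  then show ?case by simp
next
  case (Suc m)
  note pred_shift[OF Suc, measurable]
  have "descents (Suc m) J
      = (\<lambda>v. \<exists>j\<le>J. first_descent j v \<and> descents m (J - j) (\<lambda>i. v (j + i)))"
    by (rule ext) (rule descents.simps(2))
  then show ?case by simp
qed

lemma first_descent_unique: "first_descent i v \<Longrightarrow> first_descent j v \<Longrightarrow> i = j"
  unfolding first_descent_def by (metis linorder_neqE_nat not_le)

lemma first_descent_exists:
  assumes "walk v n < 0"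
  obtains j where "j \<le> n" "first_descent j v"
proof -
  let ?j = "LEAST j. walk v j < 0"
  have "walk v ?j < 0" "?j \<le> n" using assms by (auto intro: LeastI Least_le)
  moreover have "0 \<le> walk v i" if "i < ?j" for i using not_less_Least[OF that] by simp
  ultimately show thesis using that unfolding first_descent_def by blast
qed

text \<open>Conditioning on the first descent \<open>j\<close>, the weight \<open>\<beta>^j\<close> splits the factor \<open>\<beta>^(-J)\<close>
  between the time already used and the time still available.\<close>

lemma descents_bound:
  assumes \<mu>: "prob_space \<mu>" "sets \<mu> = sets borel"
    and \<beta>: "0 < \<beta>" "\<beta> \<le> 1" "\<beta> ^ L \<le> 1 / 2"
    and p: "p \<le> measure (iid \<mu>) {v. \<forall>j\<le>L. 0 \<le> walk v j}"
  shows "measure (iid \<mu>) {v. descents m J v} \<le> (1 / \<beta>) ^ J * (1 - p / 2) ^ m"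
proof -
  interpret I: prob_space "iid \<mu>" using \<mu>(1) by (rule prob_space_iid)
  have sets_pred: "{v. P v} \<in> sets (iid \<mu>)" if "Measurable.pred (PiM UNIV (\<lambda>_. borel)) P" for P
    using that unfolding sets_iid[OF \<mu>(2)] pred_def by (simp add: space_PiM)
  show ?thesis
  proof (induction m arbitrary: J)
    case 0
    have "1 \<le> (1 / \<beta>) ^ J" using \<beta> by (intro one_le_power) simp
    then show ?case using order_trans[OF I.prob_le_1] by simp
  next
    case (Suc m)
    define a where "a j = I.prob {v. first_descent j v}" for j
    have a_nonneg: "0 \<le> a j" for j by (simp add: a_def)
    have sum_a: "(\<Sum>j\<le>n. a j) = I.prob {v. \<exists>j\<le>n. first_descent j v}" for n
    proof -
      have "disjoint_family_on (\<lambda>j. {v. first_descent j v}) {..n}"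
        unfolding disjoint_family_on_def using first_descent_unique by blast
      moreover have "(\<lambda>j. {v. first_descent j v}) ` {..n} \<subseteq> I.events"
        using sets_pred[OF measurable_first_descent] by auto
      ultimately have "I.prob (\<Union>j\<le>n. {v. first_descent j v}) = (\<Sum>j\<le>n. a j)"
        unfolding a_def by (intro I.finite_measure_finite_Union) auto
      moreover have "(\<Union>j\<le>n. {v. first_descent j v}) = {v. \<exists>j\<le>n. first_descent j v}" by auto
      ultimately show ?thesis by simp
    qed
    have "(\<Sum>j\<le>L. a j) \<le> 1 - p"
    proof -
      have "Measurable.pred (PiM UNIV (\<lambda>_. borel)) (\<lambda>v. \<forall>j\<le>L. 0 \<le> walk v j)"
        by measurable
      from sets_pred[OF this] have E: "{v. \<forall>j\<le>L. 0 \<le> walk v j} \<in> I.events" .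
      have "{v. \<exists>j\<le>L. first_descent j v} \<subseteq> space (iid \<mu>) - {v. \<forall>j\<le>L. 0 \<le> walk v j}"
        unfolding first_descent_def space_iid[OF \<mu>(2)] using not_le by blast
      then have "(\<Sum>j\<le>L. a j) \<le> I.prob (space (iid \<mu>) - {v. \<forall>j\<le>L. 0 \<le> walk v j})"
        unfolding sum_a using E by (intro I.finite_measure_mono) auto
      then show ?thesis using p by (simp add: I.prob_compl[OF E])
    qed
    \<comment> \<open>A first descent by time \<open>L\<close>, of probability at most
      \<open>1 - p\<close>, may have weight up to 1; a later one weighs at most 1/2. The expected
      weight is therefore at most \<open>1 / 2 + (1 - p) / 2\<close>.\<close>
    have weight: "\<beta> ^ j \<le> 1 / 2 + (if j \<le> L then 1 / 2 else 0)" for j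
    proof (cases "j \<le> L")
      case True
      then show ?thesis using power_le_one[of \<beta> j] \<beta> by simp
    next
      case False
      then have "\<beta> ^ j \<le> \<beta> ^ L" using \<beta> by (intro power_decreasing) auto
      then show ?thesis using False \<beta>(3) by simp
    qed
    have "(\<Sum>j\<le>J. a j * \<beta> ^ j) \<le> (\<Sum>j\<le>J. a j * (1 / 2 + (if j \<le> L then 1 / 2 else 0)))"
      by (intro sum_mono mult_left_mono weight a_nonneg)
    also have "\<dots> = (\<Sum>j\<le>J. a j) / 2 + (\<Sum>j\<in>{..J} \<inter> {..L}. a j) / 2"
    proof -
      have "a j * (1 / 2 + (if j \<le> L then 1 / 2 else 0)) = a j / 2 + (if j \<in> {..L} then a j else 0) / 2"
        for j by simp
      then show ?thesis
        by (simp only: sum.distrib sum_divide_distrib sum.inter_restrict[OF finite_atMost])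
    qed
    also have "\<dots> \<le> 1 / 2 + (\<Sum>j\<le>L. a j) / 2"
    proof -
      have "(\<Sum>j\<in>{..J} \<inter> {..L}. a j) \<le> (\<Sum>j\<le>L. a j)"
        by (intro sum_mono2) (auto simp: a_nonneg)
      moreover have "(\<Sum>j\<le>J. a j) \<le> 1" unfolding sum_a by simp
      ultimately show ?thesis by simp
    qed
    also have "\<dots> \<le> 1 - p / 2" using \<open>(\<Sum>j\<le>L. a j) \<le> 1 - p\<close> by simp
    finally have ab: "(\<Sum>j\<le>J. a j * \<beta> ^ j) \<le> 1 - p / 2" .
    have p1: "0 \<le> (1 - p / 2) ^ m"
      using p I.prob_le_1[of "{v. \<forall>j\<le>L. 0 \<le> walk v j}"] by (intro zero_le_power) linarith
    have "{v. descents (Suc m) J v}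
        = (\<Union>j\<le>J. {v. first_descent j v \<and> descents m (J - j) (\<lambda>i. v (j + i))})" by auto
    moreover have "{v. first_descent j v \<and> descents m (J - j) (\<lambda>i. v (j + i))} \<in> I.events" for j
    proof -
      have "Measurable.pred (PiM UNIV (\<lambda>_. borel))
          (\<lambda>v. first_descent j v \<and> descents m (J - j) (\<lambda>i. v (j + i)))"
        by (intro pred_intros_logic measurable_first_descent pred_shift measurable_descents)
      from sets_pred[OF this] show ?thesis .
    qed
    ultimately have "I.prob {v. descents (Suc m) J v}
        \<le> (\<Sum>j\<le>J. I.prob {v. first_descent j v \<and> descents m (J - j) (\<lambda>i. v (j + i))})"
      by (simp only:) (intro I.finite_measure_subadditive_finite, auto)
    also have "\<dots> = (\<Sum>j\<le>J. a j * I.prob {v. descents m (J - j) v})"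
    proof (intro sum.cong refl)
      fix j
      have "first_descent j v = first_descent j w" if "\<And>i. i < j \<Longrightarrow> v i = w i" for v w
      proof -
        have "walk v i = walk w i" if "i \<le> j" for i
          using that \<open>\<And>i. i < j \<Longrightarrow> v i = w i\<close> unfolding walk_def by (intro sum.cong) auto
        then show ?thesis by (simp add: first_descent_def)
      qed
      then show "I.prob {v. first_descent j v \<and> descents m (J - j) (\<lambda>i. v (j + i))}
          = a j * I.prob {v. descents m (J - j) v}"
        unfolding a_def
        by (rule iid_split[OF \<mu> measurable_first_descent measurable_descents, of j j m "J - j"])
    qed
    also have "\<dots> \<le> (\<Sum>j\<le>J. a j * ((1 / \<beta>) ^ (J - j) * (1 - p / 2) ^ m))"
      by (intro sum_mono mult_left_mono Suc a_nonneg)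
    also have "\<dots> = (1 / \<beta>) ^ J * (1 - p / 2) ^ m * (\<Sum>j\<le>J. a j * \<beta> ^ j)"
      unfolding sum_distrib_left
    proof (intro sum.cong refl)
      fix j assume "j \<in> {..J}"
      then have "(1 / \<beta>) ^ J = (1 / \<beta>) ^ (J - j) * (1 / \<beta>) ^ j" by (simp flip: power_add)
      then have "(1 / \<beta>) ^ J * \<beta> ^ j = (1 / \<beta>) ^ (J - j)"
        using \<beta>(1) by (simp add: power_one_over)
      then show "a j * ((1 / \<beta>) ^ (J - j) * (1 - p / 2) ^ m)
          = (1 / \<beta>) ^ J * (1 - p / 2) ^ m * (a j * \<beta> ^ j)"
        by (metis (no_types, lifting) mult.assoc mult.commute)
    qed
    also have "\<dots> \<le> (1 / \<beta>) ^ J * (1 - p / 2) ^ m * (1 - p / 2)"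
      using ab p1 \<beta>(1) by (intro mult_left_mono) auto
    finally show ?case by (simp add: mult_ac)
  qed
qed

lemma walk_shift: "walk v (j + i) = walk v j + walk (\<lambda>i. v (j + i)) i"
  unfolding walk_def by (induction i) (simp_all add: add_ac)

text \<open>The first descent \<open>j\<close> comes no later than \<open>e 1\<close>. Seen from
  \<open>j\<close>, the times from \<open>e 1\<close> on form a chain with one link fewer, because
  each link compares with everything up to the previous time, and \<open>j\<close> need not equal
  \<open>e 1\<close>.\<close>

lemma descents_of_chain:
  assumes "\<And>i. i < m \<Longrightarrow> e i < e (Suc i)"
    and "\<And>i r. i < m \<Longrightarrow> r \<le> e i \<Longrightarrow> walk v (e (Suc i)) < walk v r"
    and "e m \<le> J"
  shows "descents m J v"
  using assms
proof (induction m arbitrary: J v e)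
  case (Suc m)
  have le: "e i \<le> e k" if "i \<le> k" "k \<le> Suc m" for i k
    using that(1,2)
  proof (induction k rule: dec_induct)
    case (step k)
    then show ?case using Suc.prems(1)[of k] by simp
  qed simp
  have "walk v (e 1) < 0" using Suc.prems(2)[of 0 0] by (simp add: walk_def)
  then obtain j where j: "j \<le> e 1" "first_descent j v" by (rule first_descent_exists)
  have je: "j \<le> e (Suc i)" if "i \<le> m" for i using j(1) le[of 1 "Suc i"] that by simp
  have "descents m (J - j) (\<lambda>i. v (j + i))"
  proof (rule Suc.IH[where e = "\<lambda>i. e (Suc i) - j"])
    show "e (Suc i) - j < e (Suc (Suc i)) - j" if "i < m" for i
      using Suc.prems(1)[of "Suc i"] je[of i] that by simp
    show "e (Suc m) - j \<le> J - j" using Suc.prems(3) by simp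
    show "walk (\<lambda>i. v (j + i)) (e (Suc (Suc i)) - j) < walk (\<lambda>i. v (j + i)) r"
      if "i < m" "r \<le> e (Suc i) - j" for i r
    proof -
      have "walk v (e (Suc (Suc i))) < walk v (j + r)"
        using that je[of i] by (intro Suc.prems(2)) auto
      moreover have "walk v (e (Suc (Suc i)))
          = walk v j + walk (\<lambda>i. v (j + i)) (e (Suc (Suc i)) - j)"
        using walk_shift[of v j "e (Suc (Suc i)) - j"] je[of "Suc i"] that by simp
      ultimately show ?thesis by (simp add: walk_shift)
    qed
  qed
  moreover have "j \<le> J" using je[of m] Suc.prems(3) by simp
  ultimately show ?case using j(2) by auto
qed simp

lemma iid_blocks:
  assumes \<mu>: "prob_space \<mu>" "sets \<mu> = sets borel"
    and P [measurable]: "Measurable.pred (PiM UNIV (\<lambda>_. borel)) P"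
    and dep: "\<And>v w. (\<And>i. i < n \<Longrightarrow> v i = w i) \<Longrightarrow> P v = P w"
  shows "measure (iid \<mu>) {v. \<forall>k<K. P (\<lambda>i. v (k * n + i))} = measure (iid \<mu>) {v. P v} ^ K"
proof (induction K)
  case 0
  interpret I: prob_space "iid \<mu>" using \<mu>(1) by (rule prob_space_iid)
  show ?case using I.prob_space by (simp add: space_iid[OF \<mu>(2)])
next
  case (Suc K)
  have "(\<forall>k<Suc K. P (\<lambda>i. v (k * n + i)))
      \<longleftrightarrow> P v \<and> (\<forall>k<K. P (\<lambda>i. v (n + (k * n + i))))" for v
    by (simp only: All_less_Suc2 add.assoc mult_Suc mult_0 add_0)
  moreover
  have "Measurable.pred (PiM UNIV (\<lambda>_. borel)) (\<lambda>v. P (\<lambda>i. v (k * n + i)))" for k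
    by (rule pred_shift[OF P])
  then have Q: "Measurable.pred (PiM UNIV (\<lambda>_. borel)) (\<lambda>v. \<forall>k<K. P (\<lambda>i. v (k * n + i)))"
    by measurable
  have "measure (iid \<mu>) {v. P v \<and> (\<forall>k<K. P (\<lambda>i. v (n + (k * n + i))))}
      = measure (iid \<mu>) {v. P v} * measure (iid \<mu>) {v. \<forall>k<K. P (\<lambda>i. v (k * n + i))}"
    using dep by (rule iid_split[OF \<mu> P Q])
  ultimately show ?case by (simp add: Suc)
qed

section \<open>Discretisation of paths and of the process\<close>

text \<open>This Fatou inequality and the reverse one below carry bounds on single grids to the
  limit of fine grids. Path properties are then compared with the measurable liminf and limsup
  events.\<close>

lemma (in prob_space) prob_liminf_le:
  assumes [measurable]: "\<And>n. A n \<in> events" and le: "eventually (\<lambda>n. prob (A n) \<le> c) sequentially"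
  shows "prob (\<Union>k. \<Inter>n\<in>{k..}. A n) \<le> c"
proof -
  have inc: "incseq (\<lambda>k. \<Inter>n\<in>{k..}. A n)" by (intro monoI) auto
  have "(\<lambda>k. prob (\<Inter>n\<in>{k..}. A n)) \<longlonglongrightarrow> prob (\<Union>k. \<Inter>n\<in>{k..}. A n)"
    by (intro finite_Lim_measure_incseq inc) auto
  then show ?thesis
  proof (rule tendsto_upperbound)
    show "eventually (\<lambda>k. prob (\<Inter>n\<in>{k..}. A n) \<le> c) sequentially"
      using le
    proof eventually_elim
      case (elim k)
      have "prob (\<Inter>n\<in>{k..}. A n) \<le> prob (A k)" by (intro finite_measure_mono) auto
      then show ?case using elim by simp
    qed
  qed simp
qed

lemma (in prob_space) prob_limsup_ge:
  assumes [measurable]: "\<And>n. A n \<in> events" and ge: "frequently (\<lambda>n. c \<le> prob (A n)) sequentially"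
  shows "c \<le> prob (\<Inter>k. \<Union>n\<in>{k..}. A n)"
proof -
  have dec: "decseq (\<lambda>k. \<Union>n\<in>{k..}. A n)" by (intro antimonoI UN_mono) auto
  have "(\<lambda>k. prob (\<Union>n\<in>{k..}. A n)) \<longlonglongrightarrow> prob (\<Inter>k. \<Union>n\<in>{k..}. A n)"
    by (intro finite_Lim_measure_decseq dec) auto
  moreover have "c \<le> prob (\<Union>n\<in>{k..}. A n)" for k
  proof -
    obtain n where n: "k \<le> n" "c \<le> prob (A n)"
      using ge by (auto simp: frequently_sequentially)
    have "prob (A n) \<le> prob (\<Union>n\<in>{k..}. A n)" using n(1) by (intro finite_measure_mono) auto
    then show ?thesis using n(2) by simp
  qed
  ultimately show ?thesis by (intro LIMSEQ_le_const) auto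
qed

section \<open>The increments of the process on a time grid\<close>

definition inc :: "(real \<Rightarrow> real) \<Rightarrow> real \<Rightarrow> nat \<Rightarrow> real" where
  "inc f h i = f (real (Suc i) * h) - f (real i * h)"

lemma walk_inc: "walk (inc f h) j = f (real j * h) - f 0"
  unfolding walk_def inc_def using sum_lessThan_telescope[of "\<lambda>i. f (real i * h)" j] by simp

context levy_process
begin

text \<open>Independence of a sequence concerns only finite subfamilies, and each of these is
  contained in an initial segment, where \<open>indep_increments\<close> applies.\<close>

lemma indep_vars_increments:
  assumes "0 \<le> h"
  shows "indep_vars (\<lambda>_. borel) (\<lambda>i \<omega>. inc (\<lambda>t. X t \<omega>) h i) UNIV"
proof -
  let ?Y = "\<lambda>i \<omega>. inc (\<lambda>t. X t \<omega>) h i"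
  have fin: "indep_vars (\<lambda>_. borel) ?Y {..<n}" for n
    unfolding inc_def using assms
    by (intro indep_increments[of "\<lambda>i. real i * h" n]) (auto intro!: mult_right_mono)
  have rv: "random_variable borel (?Y i)" for i
    unfolding inc_def using assms by (intro borel_measurable_diff measurable_X) auto
  show ?thesis
    unfolding indep_vars_def2
  proof (intro conjI ballI rv)
    show "indep_sets (\<lambda>i. {?Y i -` A \<inter> space M |A. A \<in> sets borel}) UNIV"
    proof (subst indep_sets_finite_index_sets, intro allI impI)
      fix J :: "nat set" assume "finite J"
      then obtain n where "J \<subseteq> {..<n}" using finite_nat_iff_bounded by blast
      with fin[of n] show "indep_sets (\<lambda>i. {?Y i -` A \<inter> space M |A. A \<in> sets borel}) J"
        unfolding indep_vars_def2 using indep_sets_mono_index by blast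
    qed
  qed
qed

lemma measurable_increments:
  assumes "0 \<le> h"
  shows "(\<lambda>\<omega>. inc (\<lambda>t. X t \<omega>) h) \<in> M \<rightarrow>\<^sub>M PiM UNIV (\<lambda>_. borel)"
proof (rule measurable_PiM_single')
  show "(\<lambda>\<omega>. inc (\<lambda>t. X t \<omega>) h i) \<in> M \<rightarrow>\<^sub>M borel" for i
    unfolding inc_def using assms by (intro borel_measurable_diff measurable_X) auto
qed auto

lemma distr_increments:
  assumes "0 \<le> h"
  shows "distr M (PiM UNIV (\<lambda>_. borel)) (\<lambda>\<omega>. inc (\<lambda>t. X t \<omega>) h) = iid (distr M borel (X h))"
proof -
  let ?Y = "\<lambda>i \<omega>. inc (\<lambda>t. X t \<omega>) h i"
  have rv: "random_variable borel (?Y i)" for i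
    unfolding inc_def using assms by (intro borel_measurable_diff measurable_X) auto
  have "distr M (PiM UNIV (\<lambda>_. borel)) (\<lambda>\<omega>. \<lambda>i\<in>UNIV. ?Y i \<omega>) = PiM UNIV (\<lambda>i. distr M borel (?Y i))"
    using indep_vars_iff_distr_eq_PiM[where I = UNIV and M' = "\<lambda>_. borel" and X = ?Y] rv indep_vars_increments[OF assms]
    by blast
  moreover have "distr M borel (?Y i) = distr M borel (X h)" for i
    using stationary_increments[of "real i * h" h] assms
    by (simp add: inc_def algebra_simps)
  ultimately show ?thesis by (simp add: iid_def restrict_UNIV)
qed

lemma step_law: "0 \<le> h \<Longrightarrow> prob_space (distr M borel (X h))" "sets (distr M borel (X h)) = sets borel"
  using measurable_X by (auto intro: prob_space_distr)

lemma increments_event: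
  assumes "0 \<le> h" and P: "Measurable.pred (PiM UNIV (\<lambda>_. borel)) P"
  shows "{\<omega> \<in> space M. P (inc (\<lambda>t. X t \<omega>) h)} \<in> events"
  using measurable_compose[OF measurable_increments[OF assms(1)] P] by (simp add: pred_def)

lemma prob_increments:
  assumes "0 \<le> h" and P: "Measurable.pred (PiM UNIV (\<lambda>_. borel)) P"
  shows "prob {\<omega> \<in> space M. P (inc (\<lambda>t. X t \<omega>) h)} = measure (iid (distr M borel (X h))) {v. P v}"
proof -
  have "{v. P v} \<in> sets (PiM UNIV (\<lambda>_. borel))" using P by (simp add: pred_def space_PiM)
  then show ?thesis
    unfolding distr_increments[OF assms(1), symmetric]
    by (subst measure_distr[OF measurable_increments[OF assms(1)]]) (auto intro: arg_cong[where f = prob])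
qed

end

section \<open>Record chains at dyadic times\<close>

lemma dyadic_between:
  fixes a b :: real
  assumes "0 \<le> a" "a < b"
  obtains j n where "a \<le> real j / 2 ^ n" "real j / 2 ^ n < b"
proof -
  obtain n where n: "(1 / 2) ^ n < b - a"
    using real_arch_pow_inv[of "b - a" "1 / 2"] assms by auto
  define j where "j = nat \<lceil>a * 2 ^ n\<rceil>"
  have "real j = of_int \<lceil>a * 2 ^ n\<rceil>" using assms by (simp add: j_def)
  then have "a * 2 ^ n \<le> real j" "real j < a * 2 ^ n + 1" by linarith+
  moreover have "1 < (b - a) * 2 ^ n" using n by (simp add: power_one_over field_simps)
  ultimately have "a \<le> real j / 2 ^ n" "real j / 2 ^ n < b"
    by (simp_all add: field_simps)
  then show thesis by (rule that)
qed

lemma right_limit_dyadic: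
  assumes "(f \<longlongrightarrow> f t) (at_right t)" "f t < (c :: real)" "0 \<le> t" "t < s"
  obtains j n where "t \<le> real j / 2 ^ n" "real j / 2 ^ n < s" "f (real j / 2 ^ n) < c"
proof -
  have "eventually (\<lambda>r. f r < c) (at_right t)" using assms(1,2) by (rule order_tendstoD)
  then obtain b where b: "b > t" "\<And>r. t < r \<Longrightarrow> r < b \<Longrightarrow> f r < c"
    by (auto simp: eventually_at_right_field)
  obtain j n where "t \<le> real j / 2 ^ n" "real j / 2 ^ n < min b s"
    using dyadic_between[of t "min b s"] assms b(1) by auto
  then show thesis using b(2)[of "real j / 2 ^ n"] assms(2) that[of j n]
    by (cases "t = real j / 2 ^ n") auto
qed

text \<open>The times \<open>d i\<close> accumulate at the first time before which the infimum of \<open>f\<close> over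
  \<open>[0, s)\<close> is approached. Each of them beats everything up to the previous one, and unlike the number
  of records on a time grid this is not destroyed by refining the grid.\<close>

lemma record_chain_exists:
  assumes f: "cadlag f" and "\<not> past_min_attained f"
  obtains N :: nat and d :: "nat \<Rightarrow> real" where "d 0 = 0" "\<And>i. d i < d (Suc i)" "\<And>i. d i \<le> N"
    "\<And>i. \<exists>j n. d i = real j / 2 ^ n"
    "\<And>i t. 0 \<le> t \<Longrightarrow> t \<le> d i \<Longrightarrow> f (d (Suc i)) < f t"
proof -
  obtain s where "0 < s" and s: "\<And>u. 0 \<le> u \<Longrightarrow> u < s \<Longrightarrow> \<exists>t. 0 \<le> t \<and> t < s \<and> f t < f u"
    using assms(2) unfolding past_min_attained_def by (meson not_le)
  define G where "G = {r. 0 \<le> r \<and> r \<le> s \<and> (\<exists>u. 0 \<le> u \<and> u < s \<and> (\<forall>t. 0 \<le> t \<longrightarrow> t < r \<longrightarrow> f u \<le> f t))}"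
  have "0 \<in> G" using \<open>0 < s\<close> by (auto simp: G_def)
  have bdd: "bdd_above G" by (auto simp: G_def intro: bdd_aboveI[of _ s])
  define s' where "s' = Sup G"
  have "0 \<le> s'" unfolding s'_def using \<open>0 \<in> G\<close> bdd by (rule cSup_upper)
  moreover have "s' \<le> s"
    unfolding s'_def
  proof (rule cSup_least)
    show "G \<noteq> {}" using \<open>0 \<in> G\<close> by blast
  qed (simp add: G_def)
  ultimately have s': "0 \<le> s'" "s' \<le> s" by simp_all
  \<comment> \<open>If some value bounded \<open>f\<close> from below on [0, s'), then
    \<open>s' < s\<close>, as no minimum over [0, s) exists. Some value also lies below
    \<open>f s'\<close>, and by right continuity the smaller of the two is a bound slightly beyond
    \<open>s'\<close>.\<close>
  have "s' \<notin> G"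
  proof
    assume "s' \<in> G"
    then obtain u where u: "0 \<le> u" "u < s" "\<And>t. 0 \<le> t \<Longrightarrow> t < s' \<Longrightarrow> f u \<le> f t"
      by (auto simp: G_def)
    have "s' \<noteq> s" using u s[OF u(1,2)] by force
    then have "s' < s" using s' by simp
    obtain u1 where u1: "0 \<le> u1" "u1 < s" "f u1 < f s'" using s[OF s'(1) \<open>s' < s\<close>] by blast
    define w where "w = (if f u \<le> f u1 then u else u1)"
    have w: "0 \<le> w" "w < s" "f w \<le> f u" "f w < f s'" using u u1 by (auto simp: w_def)
    have "eventually (\<lambda>r. f w < f r) (at_right s')"
      using cadlag_tendsto_right[OF f s'(1)] w(4) by (rule order_tendstoD)
    then obtain b where b: "b > s'" "\<And>r. s' < r \<Longrightarrow> r < b \<Longrightarrow> f w < f r"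
      by (auto simp: eventually_at_right_field)
    have "f w \<le> f t" if "0 \<le> t" "t < min b s" for t
      using that b(2)[of t] u(3)[of t] w by (cases t s' rule: linorder_cases) auto
    then have "min b s \<in> G"
      unfolding G_def using w b(1) s' \<open>s' < s\<close> by auto
    then have "min b s \<le> s'" unfolding s'_def using bdd by (rule cSup_upper)
    then show False using b(1) \<open>s' < s\<close> by simp
  qed
  then have "0 < s'" using \<open>0 \<in> G\<close> s'(1) by (cases "s' = 0") auto
  \<comment> \<open>Take \<open>u\<close> whose value bounds \<open>f\<close> from below up to some
    \<open>r > d\<close>. As \<open>s'\<close> is not in \<open>G\<close>, a dyadic time before
    \<open>s'\<close> has a value below \<open>f u\<close>; it cannot lie before \<open>r\<close>,
    and it beats all times up to \<open>d\<close>.\<close>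
  have step: "\<exists>e. ((\<exists>j n. e = real j / 2 ^ n) \<and> 0 \<le> e \<and> e < s')
      \<and> (d < e \<and> (\<forall>t. 0 \<le> t \<longrightarrow> t \<le> d \<longrightarrow> f e < f t))"
    if dd: "(\<exists>j n. d = real j / 2 ^ n) \<and> 0 \<le> d \<and> d < s'" for d
  proof -
    obtain r where r: "r \<in> G" "d < r"
      using dd \<open>0 \<in> G\<close> less_cSupD[of G d] unfolding s'_def by blast
    then obtain u where u: "0 \<le> u" "u < s" "\<And>t. 0 \<le> t \<Longrightarrow> t < r \<Longrightarrow> f u \<le> f t"
      by (auto simp: G_def)
    obtain t where t: "0 \<le> t" "t < s'" "f t < f u"
      using \<open>s' \<notin> G\<close> s' u(1,2) unfolding G_def by (auto simp: not_le)
    obtain j n where jn: "t \<le> real j / 2 ^ n" "real j / 2 ^ n < s'" "f (real j / 2 ^ n) < f u"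
      using right_limit_dyadic[OF cadlag_tendsto_right[OF f t(1)] t(3,1,2)] by blast
    have "r \<le> real j / 2 ^ n" using u(3)[of "real j / 2 ^ n"] jn by force
    moreover have "f (real j / 2 ^ n) < f t'" if "0 \<le> t'" "t' \<le> d" for t'
      using u(3)[of t'] dd that r(2) jn(3) by simp
    ultimately show ?thesis using jn r(2) by (intro exI[of _ "real j / 2 ^ n"]) auto
  qed
  have "\<exists>d. \<forall>i. (((\<exists>j n. d i = real j / 2 ^ n) \<and> 0 \<le> d i \<and> d i < s') \<and> (i = 0 \<longrightarrow> d i = 0))
      \<and> (d i < d (Suc i) \<and> (\<forall>t. 0 \<le> t \<longrightarrow> t \<le> d i \<longrightarrow> f (d (Suc i)) < f t))"
  proof (rule dependent_nat_choice)
    show "\<exists>d. ((\<exists>j n. d = real j / 2 ^ n) \<and> 0 \<le> d \<and> d < s') \<and> ((0::nat) = 0 \<longrightarrow> d = 0)"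
      using \<open>0 < s'\<close> by (intro exI[of _ 0]) (auto intro: exI[of _ 0])
  qed (use step in auto)
  then obtain d where d: "\<And>i. \<exists>j n. d i = real j / 2 ^ n" "\<And>i. d i < s'" "d 0 = 0"
    "\<And>i. d i < d (Suc i)" "\<And>i t. 0 \<le> t \<Longrightarrow> t \<le> d i \<Longrightarrow> f (d (Suc i)) < f t"
    by blast
  obtain N :: nat where "s' \<le> N" using real_arch_simple by blast
  then have "d i \<le> N" for i using d(2)[of i] by simp
  then show thesis using that d by blast
qed

text \<open>The first \<open>m + 1\<close> times of the record chain lie on every sufficiently fine
  dyadic grid, where they form a chain for \<open>descents_of_chain\<close>. The horizon
  \<open>N\<close> is the same for all \<open>m\<close>.\<close>

lemma descents_of_non_attained:
  assumes "cadlag f" "\<not> past_min_attained f"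
  obtains N :: nat where "\<And>m. eventually (\<lambda>n. descents m (N * 2 ^ n) (inc f (1 / 2 ^ n))) sequentially"
proof -
  obtain N :: nat and d :: "nat \<Rightarrow> real" where d: "d 0 = 0" "\<And>i. d i < d (Suc i)" "\<And>i. d i \<le> N"
    "\<And>i. \<exists>j n. d i = real j / 2 ^ n"
    "\<And>i t. 0 \<le> t \<Longrightarrow> t \<le> d i \<Longrightarrow> f (d (Suc i)) < f t"
    by (rule record_chain_exists[OF assms]) (rule that; assumption)
  have grid: "eventually (\<lambda>n. \<exists>j. d i = real j / 2 ^ n) sequentially" for i
  proof -
    obtain j n where jn: "d i = real j / 2 ^ n" using d(4) by blast
    have "d i = real (j * 2 ^ (n' - n)) / 2 ^ n'" if "n \<le> n'" for n'
    proof -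
      from that obtain k where "n' = n + k" by (auto simp: le_iff_add)
      then show ?thesis by (simp add: jn power_add)
    qed
    then show ?thesis by (intro eventually_sequentiallyI[of n]) blast
  qed
  have "eventually (\<lambda>n. descents m (N * 2 ^ n) (inc f (1 / 2 ^ n))) sequentially" for m
  proof -
    have "eventually (\<lambda>n. \<forall>i\<in>{..m}. \<exists>j. d i = real j / 2 ^ n) sequentially"
      using grid by (intro eventually_ball_finite) auto
    then show ?thesis
    proof eventually_elim
      case (elim n)
      then obtain e where e: "\<And>i. i \<le> m \<Longrightarrow> d i = real (e i) / 2 ^ n" by (metis atMost_iff)
      show ?case
      proof (rule descents_of_chain)
        show "e i < e (Suc i)" if "i < m" for i
          using d(2)[of i] that by (simp add: e divide_less_cancel)
        show "walk (inc f (1 / 2 ^ n)) (e (Suc i)) < walk (inc f (1 / 2 ^ n)) r"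
          if "i < m" "r \<le> e i" for i r
          using d(5)[of "real r / 2 ^ n" i] that by (simp add: walk_inc e divide_right_mono)
        show "e m \<le> N * 2 ^ n"
          using d(3)[of m] by (simp add: e divide_le_eq) (metis of_nat_le_iff of_nat_mult of_nat_numeral of_nat_power)
      qed
    qed
  qed
  then show thesis by (rule that)
qed

section \<open>Attainment of past minima when 0 is not regular\<close>

context levy_process
begin

lemma measurable_X_dyadic [measurable]: "(\<lambda>\<omega>. X (real j / 2 ^ n) \<omega>) \<in> borel_measurable M"
  "X 0 \<in> borel_measurable M"
  by (auto intro!: measurable_X)

lemma AE_cadlag_zero: "AE \<omega> in M. cadlag (\<lambda>t. X t \<omega>) \<and> X 0 \<omega> = 0"
  using cadlag_paths start_zero by eventually_elim simp

text \<open>If every \<open>Q k\<close> were null, the path would almost surely be negative at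
  dyadic times arbitrarily close to 0, and 0 would be regular. The \<open>2 ^ (n - k)\<close> steps
  of grid \<open>n\<close> cover the time span \<open>1 / 2 ^ k\<close>, whatever \<open>n\<close>
  is.\<close>

lemma nonneg_on_grid_of_not_regular:
  assumes "\<not> zero_regular_for_negative M X"
  obtains k p where "0 < p" "p \<le> 1"
    "\<And>n. k \<le> n \<Longrightarrow> p \<le> prob {\<omega> \<in> space M. \<forall>j\<le>2 ^ (n - k). 0 \<le> walk (inc (\<lambda>t. X t \<omega>) (1 / 2 ^ n)) j}"
proof -
  \<comment> \<open>\<open>walk_inc\<close> measures the walk from \<open>X 0\<close>, which
    vanishes only almost surely; hence the comparison with \<open>X 0\<close>.\<close>
  define Q where "Q k = {\<omega> \<in> space M. \<forall>n\<ge>k. \<forall>j\<le>2 ^ (n - k). X 0 \<omega> \<le> X (real j / 2 ^ n) \<omega>}" for k :: nat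
  have Q [measurable]: "Q k \<in> events" for k unfolding Q_def by measurable
  have "\<exists>k. prob (Q k) \<noteq> 0"
  proof (rule ccontr)
    assume "\<not> ?thesis"
    then have "AE \<omega> in M. \<omega> \<notin> Q k" for k using prob_eq_0[OF Q, of k] by simp
    then have "AE \<omega> in M. \<forall>k. \<omega> \<notin> Q k" by (simp add: AE_all_countable)
    then have "AE \<omega> in M. (INF t\<in>{t. 0 < t \<and> X t \<omega> < 0}. ereal t) = 0"
      using start_zero AE_space
    proof eventually_elim
      case (elim \<omega>)
      let ?T = "{t. 0 < t \<and> X t \<omega> < 0}"
      have "(INF t\<in>?T. ereal t) \<le> ereal e" if "0 < e" for e
      proof -
        obtain k where k: "(1 / 2) ^ k < e" using real_arch_pow_inv[OF \<open>0 < e\<close>, of "1 / 2"] by auto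
        have "\<omega> \<notin> Q k" using elim by blast
        then have "\<exists>n\<ge>k. \<exists>j\<le>2 ^ (n - k). X (real j / 2 ^ n) \<omega> < 0"
          using elim(2,3) unfolding Q_def by (auto simp: not_le)
        then obtain n j where nj: "k \<le> n" "j \<le> 2 ^ (n - k)" "X (real j / 2 ^ n) \<omega> < 0" by blast
        then have "j \<noteq> 0" using elim by (intro notI) simp
        have "real j \<le> 2 ^ (n - k)" using nj(2) by (metis of_nat_le_iff of_nat_numeral of_nat_power)
        then have "real j / 2 ^ n \<le> 2 ^ (n - k) / 2 ^ n" by (intro divide_right_mono) auto
        also have "\<dots> = (1 / 2) ^ k" using nj(1) by (simp add: power_diff power_one_over)
        finally have "real j / 2 ^ n \<le> e" using k by simp
        moreover have "(INF t\<in>?T. ereal t) \<le> ereal (real j / 2 ^ n)"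
          using nj(3) \<open>j \<noteq> 0\<close> by (intro INF_lower) simp
        ultimately show ?thesis using order_trans by fastforce
      qed
      then have "(INF t\<in>?T. ereal t) \<le> 0 + ereal e" if "0 < e" for e
        unfolding add_0 using that .
      then have "(INF t\<in>?T. ereal t) \<le> 0" by (rule ereal_le_epsilon2)
      moreover have "0 \<le> (INF t\<in>?T. ereal t)" by (intro INF_greatest) simp
      ultimately show ?case by (rule antisym)
    qed
    then show False using assms unfolding zero_regular_for_negative_def by blast
  qed
  then obtain k where k: "prob (Q k) \<noteq> 0" by blast
  have "prob (Q k) \<le> prob {\<omega> \<in> space M. \<forall>j\<le>2 ^ (n - k). 0 \<le> walk (inc (\<lambda>t. X t \<omega>) (1 / 2 ^ n)) j}"
    if "k \<le> n" for n
    using that unfolding walk_inc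
    by (intro finite_measure_mono) (auto simp: Q_def)
  moreover have "0 < prob (Q k)" using k measure_nonneg[of M "Q k"] by linarith
  ultimately show thesis using that[of "prob (Q k)" k] by simp
qed

text \<open>A cadlag path without attained minima has, for some \<open>N\<close> and every
  \<open>m\<close>, at least \<open>m\<close> descents by time \<open>N\<close> on all fine grids.
  The probability of this is bounded uniformly in the grid and geometrically in \<open>m\<close>, so
  it vanishes.\<close>

lemma AE_past_min_attained:
  assumes "\<not> zero_regular_for_negative M X"
  shows "AE \<omega> in M. past_min_attained (\<lambda>t. X t \<omega>)"
proof -
  obtain k p where p: "0 < p" "p \<le> 1" and
    grid: "\<And>n. k \<le> n \<Longrightarrow> p \<le> prob {\<omega> \<in> space M. \<forall>j\<le>2 ^ (n - k). 0 \<le> walk (inc (\<lambda>t. X t \<omega>) (1 / 2 ^ n)) j}"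
    by (rule nonneg_on_grid_of_not_regular[OF assms]) (rule that; assumption)
  define D where "D N m n = {\<omega> \<in> space M. descents m (N * 2 ^ n) (inc (\<lambda>t. X t \<omega>) (1 / 2 ^ n))}"
    for N m n :: nat
  have D [measurable]: "D N m n \<in> events" for N m n
    unfolding D_def by (rule increments_event[OF _ measurable_descents]) simp
  have D_le: "prob (D N m n) \<le> 2 ^ (N * 2 ^ k) * (1 - p / 2) ^ m" if "k \<le> n" for N m n
  proof -
    define L :: nat where "L = 2 ^ (n - k)"
    have "0 < L" by (simp add: L_def)
    \<comment> \<open>With \<open>\<beta> ^ L = 1 / 2\<close> for the \<open>L\<close> grid steps in
      a time span \<open>1 / 2 ^ k\<close>, the factor \<open>(1 / \<beta>) ^ (N * 2 ^ n)\<close>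
      equals \<open>2 ^ (N * 2 ^ k)\<close> on every grid.\<close>
    define \<beta> where "\<beta> = root L (1 / 2)"
    have \<beta>: "0 < \<beta>" "\<beta> ^ L = 1 / 2" using \<open>0 < L\<close> by (simp_all add: \<beta>_def)
    have "\<beta> \<le> 1" unfolding \<beta>_def using \<open>0 < L\<close> by simp
    let ?\<mu> = "distr M borel (X (1 / 2 ^ n))"
    have "Measurable.pred (PiM UNIV (\<lambda>_. borel)) (\<lambda>v. \<forall>j\<le>L. 0 \<le> walk v j)" by measurable
    from prob_increments[OF _ this, of "1 / 2 ^ n"] grid[OF that]
    have p_le: "p \<le> measure (iid ?\<mu>) {v. \<forall>j\<le>L. 0 \<le> walk v j}"
      by (simp add: L_def)
    have \<mu>: "prob_space ?\<mu>" "sets ?\<mu> = sets borel" by (simp_all add: step_law)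
    have "prob (D N m n) = measure (iid ?\<mu>) {v. descents m (N * 2 ^ n) v}"
      unfolding D_def by (intro prob_increments measurable_descents) simp
    also have "\<dots> \<le> (1 / \<beta>) ^ (N * 2 ^ n) * (1 - p / 2) ^ m"
      by (rule descents_bound[OF \<mu> \<beta>(1) \<open>\<beta> \<le> 1\<close> _ p_le]) (simp add: \<beta>(2))
    also have "N * 2 ^ n = L * (N * 2 ^ k)"
      using that by (simp add: L_def flip: power_add)
    also have "(1 / \<beta>) ^ (L * (N * 2 ^ k)) = 2 ^ (N * 2 ^ k)"
      unfolding power_mult[of _ L] by (simp add: power_one_over \<beta>(2))
    finally show ?thesis .
  qed
  define E where "E N m = (\<Union>i. \<Inter>n\<in>{i..}. D N m n)" for N m
  have E [measurable]: "E N m \<in> events" for N m unfolding E_def by measurable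
  have E_le: "prob (\<Inter>m. E N m) \<le> 2 ^ (N * 2 ^ k) * (1 - p / 2) ^ m" for N m
  proof -
    have "prob (\<Inter>m. E N m) \<le> prob (E N m)" by (intro finite_measure_mono) auto
    also have "\<dots> \<le> 2 ^ (N * 2 ^ k) * (1 - p / 2) ^ m"
      unfolding E_def
      by (intro prob_liminf_le eventually_sequentiallyI[of k] D D_le)
    finally show ?thesis .
  qed
  have "AE \<omega> in M. \<omega> \<notin> (\<Inter>m. E N m)" for N
  proof -
    have "(\<lambda>m. 2 ^ (N * 2 ^ k) * (1 - p / 2) ^ m) \<longlonglongrightarrow> 0"
      using p by (intro tendsto_mult_right_zero LIMSEQ_power_zero) simp
    then have "prob (\<Inter>m. E N m) \<le> 0"
      by (rule LIMSEQ_le_const) (use E_le in blast)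
    then have "prob (\<Inter>m. E N m) = 0" using measure_nonneg by (rule antisym)
    moreover have "(\<Inter>m. E N m) \<in> events" by measurable
    ultimately show ?thesis using prob_eq_0 by blast
  qed
  then have "AE \<omega> in M. \<forall>N. \<omega> \<notin> (\<Inter>m. E N m)" by (subst AE_all_countable) blast
  then show ?thesis
    using AE_cadlag_zero AE_space
  proof eventually_elim
    case (elim \<omega>)
    show ?case
    proof (rule ccontr)
      assume "\<not> ?case"
      with elim obtain N where
        "\<And>m. eventually (\<lambda>n. descents m (N * 2 ^ n) (inc (\<lambda>t. X t \<omega>) (1 / 2 ^ n))) sequentially"
        using descents_of_non_attained[of "\<lambda>t. X t \<omega>"] by blast
      then have "\<omega> \<in> E N m" for m
        using elim unfolding E_def D_def eventually_sequentially by fastforce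
      then show False using elim by blast
    qed
  qed
qed

end

section \<open>Descents without negative jumps\<close>

text \<open>Otherwise arbitrarily short grid cells carry a drop of more than \<eta>. By compactness
  they accumulate at some \<open>u\<close>, and the one-sided limits at \<open>u\<close> allow such
  drops only if \<open>f\<close> jumps down there.\<close>

lemma small_decrements_of_no_negative_jumps:
  assumes f: "cadlag f" and "0 < h" and no_jump: "\<And>t. 0 < t \<Longrightarrow> t \<le> h \<Longrightarrow> 0 \<le> jump_at f t"
    and "0 < \<eta>"
  shows "eventually (\<lambda>n. \<forall>j<2 ^ n. - \<eta> \<le> inc f (h / 2 ^ n) j) sequentially"
proof (rule ccontr)
  assume "\<not> ?thesis"
  then have "\<exists>n\<ge>k. \<exists>j<2 ^ n. inc f (h / 2 ^ n) j < - \<eta>" for k :: nat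
    unfolding eventually_sequentially by (auto simp: not_le)
  then obtain n j where n: "\<And>k. k \<le> n k" and j: "\<And>k. j k < 2 ^ n k"
    and dec: "\<And>k. inc f (h / 2 ^ n k) (j k) < - \<eta>" by metis
  define a where "a k = real (j k) * (h / 2 ^ n k)" for k
  define b where "b k = real (Suc (j k)) * (h / 2 ^ n k)" for k
  have ab: "a k < b k" "0 \<le> a k" "b k \<le> h" for k
  proof -
    show "a k < b k" "0 \<le> a k" using \<open>0 < h\<close> by (simp_all add: a_def b_def field_simps)
    have "real (Suc (j k)) \<le> 2 ^ n k" using j[of k] by (metis Suc_leI of_nat_le_iff of_nat_numeral of_nat_power)
    then have "real (Suc (j k)) * (h / 2 ^ n k) \<le> 2 ^ n k * (h / 2 ^ n k)"
      using \<open>0 < h\<close> by (intro mult_right_mono) auto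
    then show "b k \<le> h" by (simp add: b_def)
  qed
  have f_dec: "f (b k) < f (a k) - \<eta>" for k
    using dec[of k] by (simp add: inc_def a_def b_def)
  have "a k \<in> {0..h}" for k using ab[of k] by simp
  then obtain u r where u: "u \<in> {0..h}" and r: "strict_mono r" and a_lim: "(a \<circ> r) \<longlonglongrightarrow> u"
    using compact_Icc[of 0 h] unfolding compact_def by metis
  have "(\<lambda>k. b k - a k) \<longlonglongrightarrow> 0"
  proof (rule tendsto_sandwich[OF _ _ tendsto_const])
    show "eventually (\<lambda>k. 0 \<le> b k - a k) sequentially"
      using ab(1) by (intro always_eventually allI) (simp add: less_imp_le)
    show "eventually (\<lambda>k. b k - a k \<le> h * (1 / 2) ^ k) sequentially"
    proof (intro always_eventually allI)
      fix k
      have "b k - a k = h * (1 / 2) ^ n k"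
        by (simp add: a_def b_def field_simps power_one_over)
      also have "\<dots> \<le> h * (1 / 2) ^ k"
        using \<open>0 < h\<close> n[of k] by (intro mult_left_mono power_decreasing) auto
      finally show "b k - a k \<le> h * (1 / 2) ^ k" .
    qed
    show "(\<lambda>k. h * (1 / 2) ^ k) \<longlonglongrightarrow> 0"
      by (intro tendsto_mult_right_zero LIMSEQ_power_zero) simp
  qed
  from LIMSEQ_subseq_LIMSEQ[OF this r] a_lim have "(\<lambda>k. (a \<circ> r) k + ((\<lambda>k. b k - a k) \<circ> r) k) \<longlonglongrightarrow> u + 0"
    by (intro tendsto_add)
  then have b_lim: "(b \<circ> r) \<longlonglongrightarrow> u" by (simp add: o_def)
  \<comment> \<open>\<open>l\<close> is the value from the left; at \<open>u = 0\<close> the value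
    \<open>f 0\<close> takes its place, so that \<open>l \<le> f u\<close> in both cases.\<close>
  define l where "l = (if 0 < u then left_limit f u else f u)"
  have "l \<le> f u" using no_jump[of u] u by (auto simp: l_def jump_at_def)
  have "eventually (\<lambda>t. \<bar>f t - f u\<bar> < \<eta> / 3) (at_right u)"
    using tendstoD[OF cadlag_tendsto_right[OF f], of u "\<eta> / 3"] u \<open>0 < \<eta>\<close> by (simp add: dist_real_def)
  then obtain c where c: "c > u" "\<And>t. u < t \<Longrightarrow> t < c \<Longrightarrow> \<bar>f t - f u\<bar> < \<eta> / 3"
    by (auto simp: eventually_at_right_field)
  have right: "\<bar>f t - f u\<bar> < \<eta> / 3" if "u \<le> t" "t < c" for t
    using c(2)[of t] that \<open>0 < \<eta>\<close> by (cases "t = u") auto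
  obtain e where e: "e < u" "\<And>t. e < t \<Longrightarrow> t < u \<Longrightarrow> 0 \<le> t \<Longrightarrow> \<bar>f t - l\<bar> < \<eta> / 3"
  proof (cases "0 < u")
    case True
    have "eventually (\<lambda>t. \<bar>f t - l\<bar> < \<eta> / 3) (at_left u)"
      using tendstoD[OF cadlag_tendsto_left[OF f True], of "\<eta> / 3"] True \<open>0 < \<eta>\<close>
      by (simp add: dist_real_def l_def)
    then show thesis using that by (auto simp: eventually_at_left_field)
  next
    case False
    then show thesis using that[of "u - 1"] by simp
  qed
  have "eventually (\<lambda>k. e < a (r k)) sequentially" "eventually (\<lambda>k. b (r k) < c) sequentially"
    using order_tendstoD(1)[OF a_lim e(1)] order_tendstoD(2)[OF b_lim c(1)] by simp_all
  then have "eventually (\<lambda>k. e < a (r k) \<and> b (r k) < c) sequentially" by eventually_elim simp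
  then obtain k where k: "e < a (r k)" "b (r k) < c" using eventually_happens'[OF sequentially_bot] by blast
  let ?a = "a (r k)" and ?b = "b (r k)"
  \<comment> \<open>The cell lies left of \<open>u\<close>, contains \<open>u\<close>, or lies right
    of \<open>u\<close>. Its end values are within \<open>\<eta> / 3\<close> of \<open>l\<close> or
    \<open>f u\<close>, and \<open>l \<le> f u\<close>, so the drop is less than \<eta>.\<close>
  consider "?b < u" | "?a < u" "u \<le> ?b" | "u \<le> ?a" by linarith
  then show False
  proof cases
    case 1
    then show ?thesis using e(2)[of ?a] e(2)[of ?b] k ab[of "r k"] f_dec[of "r k"] \<open>0 < \<eta>\<close> by linarith
  next
    case 2
    then show ?thesis using e(2)[of ?a] right[of ?b] k ab[of "r k"] f_dec[of "r k"] \<open>0 < \<eta>\<close> \<open>l \<le> f u\<close>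
      by linarith
  next
    case 3
    then show ?thesis using right[of ?a] right[of ?b] k ab[of "r k"] f_dec[of "r k"] \<open>0 < \<eta>\<close> by linarith
  qed
qed

text \<open>The grid cells containing \<open>u\<close> shrink to \<open>u\<close>, and the
  increments over them converge to the jump at \<open>u\<close>. A bound on infinitely many grids
  therefore passes to the jump.\<close>

lemma jump_ge_of_small_decrements:
  assumes f: "cadlag f" and "0 < h"
    and small: "frequently (\<lambda>n. \<forall>j<K * 2 ^ n. - \<eta> \<le> inc f (h / 2 ^ n) j) sequentially"
    and u: "0 < u" "u \<le> real K * h"
  shows "- \<eta> \<le> jump_at f u"
proof -
  \<comment> \<open>The ceiling minus 1 selects the cell with \<open>a n < u \<le> b n\<close>, also
    when \<open>u\<close> is a grid point. The strict inequality makes \<open>f (a n)\<close>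
    converge to the left limit.\<close>
  define j where "j n = nat (\<lceil>u * 2 ^ n / h\<rceil> - 1)" for n :: nat
  define a where "a n = real (j n) * (h / 2 ^ n)" for n
  define b where "b n = real (Suc (j n)) * (h / 2 ^ n)" for n
  have pos: "0 < \<lceil>u * 2 ^ n / h\<rceil>" for n using u \<open>0 < h\<close> by simp
  then have j: "real (Suc (j n)) = of_int \<lceil>u * 2 ^ n / h\<rceil>" for n
    using pos[of n] by (simp add: j_def)
  have ab: "a n < u" "u \<le> b n" "b n - a n = h * (1 / 2) ^ n" for n
  proof -
    have "u * 2 ^ n / h \<le> real (Suc (j n))" "real (j n) < u * 2 ^ n / h"
      using j[of n] by linarith+
    then show "a n < u" "u \<le> b n" using \<open>0 < h\<close> by (simp_all add: a_def b_def field_simps)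
    show "b n - a n = h * (1 / 2) ^ n" by (simp add: a_def b_def field_simps power_one_over)
  qed
  have "j n < K * 2 ^ n" for n
  proof -
    have "u * 2 ^ n / h \<le> real (K * 2 ^ n)" using u(2) \<open>0 < h\<close> by (simp add: field_simps)
    then have "\<lceil>u * 2 ^ n / h\<rceil> \<le> int (K * 2 ^ n)" by (simp add: ceiling_le_iff)
    then show ?thesis using pos[of n] unfolding j_def by linarith
  qed
  then have "frequently (\<lambda>n. - \<eta> \<le> f (b n) - f (a n)) sequentially"
    using small by (auto elim!: frequently_elim1 simp: inc_def a_def b_def)
  have h0: "(\<lambda>n. h * (1 / 2) ^ n) \<longlonglongrightarrow> 0" by (intro tendsto_mult_right_zero LIMSEQ_power_zero) simp
  have "a \<longlonglongrightarrow> u"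
  proof (rule tendsto_sandwich[OF _ _ _ tendsto_const])
    show "eventually (\<lambda>n. u - h * (1 / 2) ^ n \<le> a n) sequentially"
      using ab by (intro always_eventually allI) (smt (verit))
    show "(\<lambda>n. u - h * (1 / 2) ^ n) \<longlonglongrightarrow> u" using tendsto_diff[OF tendsto_const h0] by simp
  qed (use ab(1) in \<open>auto intro!: always_eventually less_imp_le\<close>)
  moreover have "b \<longlonglongrightarrow> u"
  proof (rule tendsto_sandwich[OF _ _ tendsto_const])
    show "eventually (\<lambda>n. b n \<le> u + h * (1 / 2) ^ n) sequentially"
      using ab by (intro always_eventually allI) (smt (verit))
    show "(\<lambda>n. u + h * (1 / 2) ^ n) \<longlonglongrightarrow> u" using tendsto_add[OF tendsto_const h0] by simp
  qed (use ab(2) in auto)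
  ultimately have fl: "filterlim a (at_left u) sequentially" and fr: "b \<longlonglongrightarrow> u"
    using ab(1) by (auto simp: filterlim_at intro!: always_eventually less_imp_neq)
  have "(\<lambda>n. f (a n)) \<longlonglongrightarrow> left_limit f u"
    using cadlag_tendsto_left[OF f u(1)] fl by (rule filterlim_compose)
  moreover have "(\<lambda>n. f (b n)) \<longlonglongrightarrow> f u"
  proof -
    \<comment> \<open>\<open>b n = u\<close> may occur, so the limit is taken within
      \<open>{u..}\<close>.\<close>
    have "(f \<longlongrightarrow> f u) (at u within {u..})"
      using cadlag_tendsto_right[OF f] u(1) by (simp add: at_within_Ici_at_right)
    then show ?thesis
      using fr ab(2) continuous_within_tendsto_compose'[of u "{u..}" f b sequentially]
      by (simp add: continuous_within)
  qed
  ultimately have lim: "(\<lambda>n. f (b n) - f (a n)) \<longlonglongrightarrow> jump_at f u"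
    using u(1) by (auto simp: jump_at_def intro: tendsto_diff)
  show ?thesis
  proof (rule ccontr)
    assume "\<not> ?thesis"
    then have "eventually (\<lambda>n. f (b n) - f (a n) < - \<eta>) sequentially"
      using order_tendstoD(2)[OF lim] by simp
    with \<open>frequently (\<lambda>n. - \<eta> \<le> f (b n) - f (a n)) sequentially\<close> show False
      by (auto simp: frequently_def not_le elim: eventually_mono)
  qed
qed

text \<open>The left limit at the passage time is nonnegative since the path was positive before,
  and at most the nonpositive value there since the jump is not negative.\<close>

lemma creeps_of_no_negative_jumps:
  assumes f: "cadlag f" and "0 < f 0" "0 \<le> T" "f T \<le> 0"
    and no_jump: "\<And>t. 0 < t \<Longrightarrow> t \<le> T \<Longrightarrow> 0 \<le> jump_at f t"
  shows "passage_time f < \<infinity> \<and> left_limit f (real_of_ereal (passage_time f)) = 0"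
  using f
proof (cases rule: passage_time_cases)
  case never
  then show ?thesis using assms(3,4) by (meson not_less)
next
  case (passes \<tau>)
  then have "0 < \<tau>" using assms(2) by (cases "\<tau> = 0") auto
  have "\<tau> \<le> T" using passes(4)[of T] assms(3,4) by force
  have "eventually (\<lambda>t. 0 \<le> f t) (at_left \<tau>)"
    using eventually_at_left_real[OF \<open>0 < \<tau>\<close>]
    by eventually_elim (use passes(4) in \<open>auto intro: less_imp_le\<close>)
  then have "0 \<le> left_limit f \<tau>"
    by (intro tendsto_lowerbound[OF cadlag_tendsto_left[OF f \<open>0 < \<tau>\<close>]]) auto
  moreover have "left_limit f \<tau> \<le> 0"
    using no_jump[OF \<open>0 < \<tau>\<close> \<open>\<tau> \<le> T\<close>] passes(3) \<open>0 < \<tau>\<close> by (simp add: jump_at_def)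
  ultimately show ?thesis using passes(2) by simp
qed

text \<open>This is the measurable grid substitute for a descent by more than \<epsilon> without
  negative jumps. The mesh tends to 0 first, for each fixed \<eta>, and then \<eta> does.\<close>

definition slow_descent :: "real \<Rightarrow> real \<Rightarrow> nat \<Rightarrow> (nat \<Rightarrow> real) \<Rightarrow> bool" where
  "slow_descent \<eta> \<epsilon> n v \<longleftrightarrow> (\<forall>j<n. - \<eta> \<le> v j) \<and> walk v n < - \<epsilon>"

lemma measurable_slow_descent [measurable]:
  "Measurable.pred (PiM UNIV (\<lambda>_. borel)) (slow_descent \<eta> \<epsilon> n)"
  unfolding slow_descent_def[abs_def] by measurable

lemma slow_descent_blocks:
  assumes "\<forall>k<K. slow_descent \<eta> \<epsilon> n (\<lambda>i. v (k * n + i))"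
  shows "\<forall>j<K * n. - \<eta> \<le> v j" and "walk v (K * n) \<le> - (real K * \<epsilon>)"
proof -
  show "\<forall>j<K * n. - \<eta> \<le> v j"
  proof (intro allI impI)
    fix j assume "j < K * n"
    then have "0 < n" by (intro gr0I) simp
    with \<open>j < K * n\<close> have "j div n < K" "j mod n < n" by (simp_all add: less_mult_imp_div_less)
    with assms have "- \<eta> \<le> v (j div n * n + j mod n)" unfolding slow_descent_def by blast
    then show "- \<eta> \<le> v j" by simp
  qed
  show "walk v (K * n) \<le> - (real K * \<epsilon>)"
    using assms
  proof (induction K)
    case (Suc K)
    then have "walk v (K * n) \<le> - (real K * \<epsilon>)" "walk (\<lambda>i. v (K * n + i)) n \<le> - \<epsilon>"
      by (auto simp: slow_descent_def less_imp_le)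
    then show ?case using walk_shift[of v "K * n" n] by (simp add: algebra_simps)
  qed (simp add: walk_def)
qed

lemma nonneg_of_ge_minus_inverse:
  assumes "\<And>i. - (1 / real (Suc i)) \<le> x"
  shows "0 \<le> x"
proof (rule ccontr)
  assume "\<not> 0 \<le> x"
  then obtain n where "inverse (real (Suc n)) < - x" using reals_Archimedean[of "- x"] by auto
  then show False using assms[of n] by (simp add: inverse_eq_divide)
qed

section \<open>From condition (a) to condition (b)\<close>

context levy_process
begin

text \<open>For fixed \<open>i\<close>, refining the grid excludes jumps below
  \<open>- 1 / (i + 1)\<close> up to time \<open>K * h\<close>; as \<open>i\<close> is arbitrary, no
  negative jump remains. The \<open>K\<close> blocks together descend by at least \<open>x\<close>,
  so the path started from \<open>x\<close> creeps.\<close>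

lemma creeps_of_slow_descents:
  assumes \<omega>: "cadlag (\<lambda>t. X t \<omega>)" "X 0 \<omega> = 0" and pos: "0 < h" "0 < x" "x \<le> real K * \<epsilon>"
    and slow: "\<And>i. frequently (\<lambda>n. \<forall>k<K. slow_descent (1 / real (Suc i)) \<epsilon> (2 ^ n)
      (\<lambda>j. inc (\<lambda>t. X t \<omega>) (h / 2 ^ n) (k * 2 ^ n + j))) sequentially"
  shows "passage_time (\<lambda>t. x + X t \<omega>) < \<infinity> \<and>
    left_limit (\<lambda>t. x + X t \<omega>) (real_of_ereal (passage_time (\<lambda>t. x + X t \<omega>))) = 0"
proof -
  let ?f = "\<lambda>t. x + X t \<omega>"
  have inc_f: "inc ?f = inc (\<lambda>t. X t \<omega>)" by (intro ext) (simp add: inc_def)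
  have f: "cadlag ?f"
    using \<omega>(1) by (rule cadlag_shift)
  have "0 \<le> jump_at ?f t" if t: "0 < t" "t \<le> real K * h" for t
  proof -
    have "- (1 / real (Suc i)) \<le> jump_at ?f t" for i
    proof (rule jump_ge_of_small_decrements[OF f \<open>0 < h\<close> _ t])
      show "frequently (\<lambda>n. \<forall>j<K * 2 ^ n. - (1 / real (Suc i)) \<le> inc ?f (h / 2 ^ n) j) sequentially"
        using slow[of i] unfolding inc_f
      proof (rule frequently_elim1)
        fix n
        assume "\<forall>k<K. slow_descent (1 / real (Suc i)) \<epsilon> (2 ^ n)
          (\<lambda>j. inc (\<lambda>t. X t \<omega>) (h / 2 ^ n) (k * 2 ^ n + j))"
        from slow_descent_blocks(1)[OF this]
        show "\<forall>j<K * 2 ^ n. - (1 / real (Suc i)) \<le> inc (\<lambda>t. X t \<omega>) (h / 2 ^ n) j" .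
      qed
    qed
    then show ?thesis by (rule nonneg_of_ge_minus_inverse)
  qed
  moreover have "?f (real K * h) \<le> 0"
  proof -
    obtain n where "\<forall>k<K. slow_descent (1 / real (Suc 0)) \<epsilon> (2 ^ n)
        (\<lambda>j. inc (\<lambda>t. X t \<omega>) (h / 2 ^ n) (k * 2 ^ n + j))"
      using slow[of 0] unfolding frequently_sequentially by blast
    from slow_descent_blocks(2)[OF this] show ?thesis
      using \<omega>(2) pos(3) by (simp add: walk_inc)
  qed
  ultimately show ?thesis
    using pos \<omega>(2) by (intro creeps_of_no_negative_jumps[OF f, of "real K * h"]) auto
qed

text \<open>Concatenating \<open>K\<close> independent copies of a descent by \<open>\<epsilon>\<close> without negative jumps yields one
  below any given level; such a descent creeps.\<close>

lemma AE_no_slow_descent: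
  assumes "\<not> creeps_downward M X" and pos: "0 < h" "0 < \<epsilon>"
  shows "AE \<omega> in M. (\<forall>t. 0 < t \<longrightarrow> t \<le> h \<longrightarrow> 0 \<le> jump_at (\<lambda>t. X t \<omega>) t) \<longrightarrow> - \<epsilon> \<le> X h \<omega>"
proof -
  obtain x where "0 < x" and not_creep: "AE \<omega> in M.
        \<not> (passage_time (\<lambda>t. x + X t \<omega>) < \<infinity> \<and>
           left_limit (\<lambda>t. x + X t \<omega>) (real_of_ereal (passage_time (\<lambda>t. x + X t \<omega>))) = 0)"
    using assms(1) unfolding creeps_downward_def by blast
  obtain K :: nat where K: "x \<le> real K * \<epsilon>"
    using reals_Archimedean3[OF pos(2)] less_imp_le by blast
  define F where "F i n = {\<omega> \<in> space M. slow_descent (1 / real (Suc i)) \<epsilon> (2 ^ n)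
      (inc (\<lambda>t. X t \<omega>) (h / 2 ^ n))}" for i n
  define H where "H i n = {\<omega> \<in> space M. \<forall>k<K. slow_descent (1 / real (Suc i)) \<epsilon> (2 ^ n)
      (\<lambda>j. inc (\<lambda>t. X t \<omega>) (h / 2 ^ n) (k * 2 ^ n + j))}" for i n
  have h: "0 \<le> h / 2 ^ n" for n using pos by simp
  have blocks: "Measurable.pred (PiM UNIV (\<lambda>_. borel))
      (\<lambda>v. \<forall>k<K. slow_descent \<eta> \<epsilon> n (\<lambda>j. v (k * n + j)))" for \<eta> n
  proof -
    have "Measurable.pred (PiM UNIV (\<lambda>_. borel)) (\<lambda>v. slow_descent \<eta> \<epsilon> n (\<lambda>j. v (k * n + j)))" for k
      by (rule pred_shift[OF measurable_slow_descent])
    then show ?thesis by measurable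
  qed
  have F [measurable]: "F i n \<in> events" for i n
    unfolding F_def by (rule increments_event[OF h measurable_slow_descent])
  have H [measurable]: "H i n \<in> events" for i n
    unfolding H_def by (rule increments_event[OF h blocks])
  have HF: "prob (H i n) = prob (F i n) ^ K" for i n
  proof -
    let ?\<mu> = "distr M borel (X (h / 2 ^ n))" and ?P = "slow_descent (1 / real (Suc i)) \<epsilon> (2 ^ n)"
    have dep: "?P v = ?P w" if "\<And>i. i < 2 ^ n \<Longrightarrow> v i = w i" for v w
    proof -
      have "walk v (2 ^ n) = walk w (2 ^ n)" using that unfolding walk_def by (intro sum.cong) auto
      then show ?thesis using that by (simp add: slow_descent_def)
    qed
    have "prob (H i n) = measure (iid ?\<mu>) {v. \<forall>k<K. ?P (\<lambda>j. v (k * 2 ^ n + j))}"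
      unfolding H_def by (rule prob_increments[OF h blocks])
    also have "\<dots> = measure (iid ?\<mu>) {v. ?P v} ^ K"
      by (rule iid_blocks[OF step_law(1)[OF h] step_law(2) measurable_slow_descent]) (rule dep)
    also have "measure (iid ?\<mu>) {v. ?P v} = prob (F i n)"
      unfolding F_def by (rule prob_increments[OF h measurable_slow_descent, symmetric])
    finally show ?thesis .
  qed
  \<comment> \<open>\<open>B\<close> asks for slow descents on all fine grids, \<open>G i\<close>
    for \<open>K\<close> successive ones on infinitely many grids. If \<open>B\<close> had positive
    probability, \<open>F i n\<close> would have at least half of it for infinitely many
    \<open>n\<close>. The resulting bound \<open>(prob B / 2) ^ K\<close> for \<open>G i\<close>
    does not depend on \<open>i\<close>, so it survives the intersection over
    \<open>i\<close>.\<close>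
  define B where "B = (\<Inter>i. \<Union>m. \<Inter>n\<in>{m..}. F i n)"
  define G where "G i = (\<Inter>m. \<Union>n\<in>{m..}. H i n)" for i
  have B: "B \<in> events" unfolding B_def by measurable
  have G [measurable]: "G i \<in> events" for i unfolding G_def by measurable
  have "prob B = 0"
  proof (rule ccontr)
    assume "prob B \<noteq> 0"
    then have p: "0 < prob B" using measure_nonneg[of M B] by linarith
    have "(prob B / 2) ^ K \<le> prob (G i)" for i
      unfolding G_def
    proof (rule prob_limsup_ge[OF H])
      have "frequently (\<lambda>n. prob B / 2 \<le> prob (F i n)) sequentially"
      proof (rule ccontr)
        assume "\<not> ?thesis"
        then have "eventually (\<lambda>n. prob (F i n) \<le> prob B / 2) sequentially"
          unfolding frequently_def not_not by (rule eventually_mono) simp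
        then have "prob (\<Union>m. \<Inter>n\<in>{m..}. F i n) \<le> prob B / 2" by (rule prob_liminf_le[OF F])
        moreover have "prob B \<le> prob (\<Union>m. \<Inter>n\<in>{m..}. F i n)"
          unfolding B_def by (intro finite_measure_mono) auto
        ultimately show False using p by simp
      qed
      then show "frequently (\<lambda>n. (prob B / 2) ^ K \<le> prob (H i n)) sequentially"
        unfolding HF by (rule frequently_elim1) (use p in \<open>auto intro: power_mono\<close>)
    qed
    moreover have "decseq G"
    proof (rule decseq_SucI)
      fix i
      have "(1 / real (Suc (Suc i))) \<le> 1 / real (Suc i)" by (simp add: field_simps)
      then have "H (Suc i) n \<subseteq> H i n" for n
        unfolding H_def slow_descent_def by (fastforce intro: order_trans)
      then show "G (Suc i) \<subseteq> G i" unfolding G_def by blast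
    qed
    then have "(\<lambda>i. prob (G i)) \<longlonglongrightarrow> prob (\<Inter>i. G i)"
      by (intro finite_Lim_measure_decseq) auto
    ultimately have "(prob B / 2) ^ K \<le> prob (\<Inter>i. G i)" by (intro LIMSEQ_le_const) auto
    then have "prob (\<Inter>i. G i) \<noteq> 0" using zero_less_power[of "prob B / 2" K] p by linarith
    moreover have "AE \<omega> in M. \<omega> \<notin> (\<Inter>i. G i)"
      using not_creep AE_cadlag_zero AE_space
    proof eventually_elim
      case (elim \<omega>)
      show ?case
      proof
        assume "\<omega> \<in> (\<Inter>i. G i)"
        then have "frequently (\<lambda>n. \<forall>k<K. slow_descent (1 / real (Suc i)) \<epsilon> (2 ^ n)
            (\<lambda>j. inc (\<lambda>t. X t \<omega>) (h / 2 ^ n) (k * 2 ^ n + j))) sequentially" for i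
          unfolding frequently_sequentially G_def H_def by fastforce
        then show False
          using creeps_of_slow_descents[of \<omega>, OF _ _ pos(1) \<open>0 < x\<close> K] elim(1,2) by blast
      qed
    qed
    moreover have "(\<Inter>i. G i) \<in> events" by measurable
    ultimately show False using prob_eq_0 by blast
  qed
  then have "AE \<omega> in M. \<omega> \<notin> B" using prob_eq_0[OF B] by blast
  then show ?thesis
    using AE_cadlag_zero AE_space
  proof eventually_elim
    case (elim \<omega>)
    let ?f = "\<lambda>t. X t \<omega>"
    show ?case
    proof (intro impI, rule ccontr)
      assume no_jump: "\<forall>t. 0 < t \<longrightarrow> t \<le> h \<longrightarrow> 0 \<le> jump_at ?f t" and "\<not> - \<epsilon> \<le> X h \<omega>"
      then have low: "walk (inc ?f (h / 2 ^ n)) (2 ^ n) < - \<epsilon>" for n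
        using elim by (simp add: walk_inc)
      have "eventually (\<lambda>n. \<forall>j<2 ^ n. - (1 / real (Suc i)) \<le> inc ?f (h / 2 ^ n) j) sequentially" for i
        using elim no_jump pos by (intro small_decrements_of_no_negative_jumps) auto
      then have "eventually (\<lambda>n. \<omega> \<in> F i n) sequentially" for i
        by (rule eventually_mono) (use low elim in \<open>auto simp: F_def slow_descent_def\<close>)
      then have "\<omega> \<in> B" unfolding B_def eventually_sequentially by fastforce
      then show False using elim by simp
    qed
  qed
qed

text \<open>The mean number of negative jumps in (0, 1] is finite, but regularity and
  \<open>AE_no_slow_descent\<close> together make this number almost surely infinite.\<close>

lemma not_regular_of_not_creeping:
  assumes \<pi>: "has_levy_measure M X \<pi>" "emeasure \<pi> {..<0} < \<infinity>" and "\<not> creeps_downward M X"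
  shows "\<not> zero_regular_for_negative M X"
proof
  assume reg: "zero_regular_for_negative M X"
  let ?J = "\<lambda>\<omega>. {t\<in>{0<..1}. jump_at (\<lambda>s. X s \<omega>) t \<noteq> 0 \<and> jump_at (\<lambda>s. X s \<omega>) t \<in> {..<0}}"
  \<comment> \<open>One null set serves all dyadic times and tolerances; right continuity extends
    the bound to all times. \<open>Suc j\<close> keeps the time positive, and time 0 is settled by
    \<open>X 0 = 0\<close>.\<close>
  have "AE \<omega> in M. (\<forall>t. 0 < t \<longrightarrow> t \<le> real (Suc j) / 2 ^ n \<longrightarrow> 0 \<le> jump_at (\<lambda>t. X t \<omega>) t)
      \<longrightarrow> - (1 / real (Suc i)) \<le> X (real (Suc j) / 2 ^ n) \<omega>" for i j n
    by (rule AE_no_slow_descent[OF assms(3)]) auto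
  then have "AE \<omega> in M. \<forall>i j n. (\<forall>t. 0 < t \<longrightarrow> t \<le> real (Suc j) / 2 ^ n \<longrightarrow> 0 \<le> jump_at (\<lambda>t. X t \<omega>) t)
      \<longrightarrow> - (1 / real (Suc i)) \<le> X (real (Suc j) / 2 ^ n) \<omega>"
    by (simp add: AE_all_countable del: of_nat_Suc)
  then have "AE \<omega> in M. emeasure (count_space UNIV) (?J \<omega>) = \<infinity>"
    using AE_cadlag_zero reg[unfolded zero_regular_for_negative_def]
  proof eventually_elim
    case (elim \<omega>)
    have neg_jump: "\<exists>t. 0 < t \<and> t \<le> s \<and> jump_at (\<lambda>t. X t \<omega>) t < 0" if "0 < s" for s
    proof (rule ccontr)
      assume *: "\<not> ?thesis"
      have dyadic: "0 \<le> X (real j / 2 ^ n) \<omega>" if "real j / 2 ^ n < s" for j n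
      proof (cases j)
        case 0
        then show ?thesis using elim by simp
      next
        case (Suc j')
        have "- (1 / real (Suc i)) \<le> X (real j / 2 ^ n) \<omega>" for i
          using elim(1) * that unfolding Suc by (meson not_le order_trans less_imp_le)
        then show ?thesis by (rule nonneg_of_ge_minus_inverse)
      qed
      have "0 \<le> X t \<omega>" if "0 < t" "t < s" for t
      proof (rule ccontr)
        assume "\<not> 0 \<le> X t \<omega>"
        then have "X t \<omega> < 0" "0 \<le> t" using that by simp_all
        moreover have "((\<lambda>t. X t \<omega>) \<longlongrightarrow> X t \<omega>) (at_right t)"
          using elim(2) \<open>0 \<le> t\<close> by (intro cadlag_tendsto_right) auto
        ultimately obtain j n where "real j / 2 ^ n < s" "X (real j / 2 ^ n) \<omega> < 0"
          using right_limit_dyadic[of "\<lambda>t. X t \<omega>" t 0 s] \<open>t < s\<close> by blast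
        then show False using dyadic[of j n] by simp
      qed
      then have "ereal s \<le> (INF t\<in>{t. 0 < t \<and> X t \<omega> < 0}. ereal t)"
        by (intro INF_greatest) (force simp: not_le)
      then show False using elim(3) \<open>0 < s\<close> by simp
    qed
    \<comment> \<open>A finite nonempty set would have an earliest negative jump, yet another one
      occurs by half that time.\<close>
    have "infinite (?J \<omega>)"
    proof
      assume fin: "finite (?J \<omega>)"
      have "?J \<omega> \<noteq> {}" using neg_jump[of 1] by force
      define m where "m = Min (?J \<omega>)"
      have "m \<in> ?J \<omega>" unfolding m_def using fin \<open>?J \<omega> \<noteq> {}\<close> by (rule Min_in)
      then obtain t where t: "0 < t" "t \<le> m / 2" "jump_at (\<lambda>t. X t \<omega>) t < 0"
        using neg_jump[of "m / 2"] by auto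
      then have "t \<in> ?J \<omega>" using \<open>m \<in> ?J \<omega>\<close> by auto
      then have "m \<le> t" unfolding m_def using fin by (intro Min_le)
      then show False using t \<open>m \<in> ?J \<omega>\<close> by simp
    qed
    then show ?case by (subst emeasure_count_space_infinite) auto
  qed
  then have "(\<integral>\<^sup>+\<omega>. emeasure (count_space UNIV) (?J \<omega>) \<partial>M) = (\<integral>\<^sup>+\<omega>. \<infinity> \<partial>M)"
    by (rule nn_integral_cong_AE)
  also have "\<dots> = \<infinity>" by (simp add: emeasure_space_1)
  finally have "emeasure \<pi> {..<0} = \<infinity>"
    using \<pi>(1) unfolding has_levy_measure_def by simp
  then show False using \<pi>(2) by simp
qed

end

theorem proposition2:
  fixes M :: "'a measure" and X :: "real \<Rightarrow> 'a \<Rightarrow> real" and \<pi> :: "real measure"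
  assumes "levy_process M X"
    and "has_levy_measure M X \<pi>"
    and "(\<not> creeps_downward M X \<and> 0 < emeasure \<pi> {..<0} \<and> emeasure \<pi> {..<0} < \<infinity>)
         \<or> \<not> zero_regular_for_negative M X"
  shows "\<forall>x>0. AE \<omega> in M. absorption_time (\<lambda>t. x + X t \<omega>) = \<infinity>"
proof (intro allI impI)
  fix x :: real assume "0 < x"
  interpret levy_process M X by fact
  have "\<not> zero_regular_for_negative M X"
    using assms(3) not_regular_of_not_creeping[OF assms(2)] by blast
  from AE_past_min_attained[OF this] AE_cadlag_zero
  show "AE \<omega> in M. absorption_time (\<lambda>t. x + X t \<omega>) = \<infinity>"
  proof eventually_elim
    case (elim \<omega>)
    have "cadlag (\<lambda>t. x + X t \<omega>)"
      using elim(2) by (intro cadlag_shift) simp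
    then show ?case
      using elim \<open>0 < x\<close> by (intro absorption_time_eq_infinity) (simp_all add: past_min_attained_shift)
  qed
qed

end
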